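(* Let $1\le p\le2$. Assume that there exists a purely imaginary unit paravector $I\in\mathbb{S}$ such that $f|_{I\mathbb{R}}\in L^p(\mathbb{R})$ and $\operatorname{supp}\mathscr{F}_I(f|_{I\mathbb{R}})\subset(-\infty,0]$. Then $f\in H^p_{\mathrm{slice}}(\mathbb{R}^{n+1}_+)$.
   Context: $\mathbb{R}_n$ is the real Clifford algebra generated by $\mathbf{e}_1,\dots,\mathbf{e}_n$ with $\mathbf{e}_r\mathbf{e}_s+\mathbf{e}_s\mathbf{e}_r=-2\delta_{rs}$; its elements are $a=\sum_A a_A\mathbf{e}_A$ ($a_A\in\mathbb{R}$, $A\subseteq\{1,\dots,n\}$ ordered, $\mathbf{e}_A$ the corresponding ordered product, $\mathbf{e}_\varnothing=1$), with norm $|a|=(\sum_A a_A^2)^{1/2}$. $\mathbb{R}^{n+1}$ is identified with the set of paravectors $x_0+x_1\mathbf{e}_1+\dots+x_n\mathbf{e}_n$. $\mathbb{S}=\{x_1\mathbf{e}_1+\dots+x_n\mathbf{e}_n:\ x_1^2+\dots+x_n^2=1\}$, so $I^2=-1$ for $I\in\mathbb{S}$; $L_I=\mathbb{R}+I\mathbb{R}\cong\mathbb{C}$. For $U\subseteq\mathbb{R}^{n+1}$ open, a real differentiable $f:U\to\mathbb{R}_n$ is left slice monogenic, written $f\in\mathcal{SM}_l(U)$, if for every $I\in\mathbb{S}$, $\frac12\left(\frac{\partial}{\partial u}+I\frac{\partial}{\partial v}\right)f(u+Iv)=0$ on $U\cap L_I$. $\mathbb{R}^{n+1}_+=\{u+Iv:\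 u>0,\ v\in\mathbb{R},\ I\in\mathbb{S}\}$ and $\Pi_{+,I}=\mathbb{R}^{n+1}_+\cap L_I$. Meaning of $f$: the datum is a function $f:I\mathbb{R}\to\mathbb{R}_n$, with $f|_{I\mathbb{R}}$ denoting $v\mapsto f(Iv)$. The same letter $f$ denotes its extension to $\mathbb{R}^{n+1}_+$, given for $u>0$, $v\in\mathbb{R}$ by $f(u+Iv)=\int_{\mathbb{R}}\mathscr{P}(u,v-w)f(Iw)\,dw$ on $\Pi_{+,I}$, where $\mathscr{P}(u,v)=|\mathscr{K}(u+Iv)|^2/\mathscr{K}(2u)$ and $\mathscr{K}(z)=\frac1{2\pi}\int_{-\infty}^0e^{zw}\,dw$ (so $\mathscr{P}$ is the Poisson kernel), and for every $J\in\mathbb{S}$ by $f(u+Jv)=\frac12[f(u-Iv)+f(u+Iv)]+\frac{JI}{2}[f(u-Iv)-f(u+Iv)]$. The original $f(Iv)$ is the non-tangential boundary limit of this extension at $Iv$ for almost every $v$. For $1\le p\le2$, $H^p_{\mathrm{slice}}(\mathbb{R}^{n+1}_+)$ is the space of functions $f\in\mathcal{SM}_l(\mathbb{R}^{n+1}_+)$ such that $\sup_{J\in\mathbb{S}}\int_{\mathbb{R}}|f(Jv)|^p\,dv<\infty$, where $f(Jv)$ denotes the non-tangential boundary limit (taken within $\Pi_{+,J}$) of $f$ at $Jv$, for almost every $v\in\mathbb{R}$. One-dimensional left-sided Clifford Fourier transform: for $I\in\mathbb{S}$ and $g\in L^1(\mathbb{R})$ with values in $\mathbb{R}_n$, $\mathscr{F}_I(g)(w)=\frac{1}{\sqrt{2\pi}}\int_{\mathbb{R}}e^{-Ivw}g(v)\,dv$,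 extended to $\mathbb{R}_n$-valued $g\in L^p(\mathbb{R})$, $1\le p\le2$, by continuity (Hausdorff–Young). *)

theory Defs
  imports "HOL-Analysis.Analysis"
begin

section \<open>The Clifford algebra\<close>

text \<open>
  The algebra with generators \<open>e i\<close>, \<open>i :: 'n\<close>, has the real basis \<open>e A\<close>, \<open>A :: 'n set\<close>, so its
  elements are coefficient vectors indexed by \<open>'n set\<close>, \<open>n = CARD('n)\<close>; the Euclidean norm of this
  vector type is the norm used throughout. The ring operations \<open>*\<close> and \<open>1\<close> that the library puts
  on vectors are componentwise and are \<^emph>\<open>not\<close> those of the Clifford algebra.
\<close>

type_synonym 'n cliff = "(real, 'n set) vec"

definition cl_basis :: "'n::finite set \<Rightarrow> 'n cliff" where
  "cl_basis A = axis A 1"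

abbreviation cl_one :: "'n::finite cliff" where
  "cl_one \<equiv> cl_basis {}"

abbreviation cl_gen :: "'n::finite \<Rightarrow> 'n cliff" where
  "cl_gen i \<equiv> cl_basis {i}"

text \<open>
  Reordering \<open>e A e B\<close> costs a sign for every pair \<open>i \<in> A\<close>, \<open>j \<in> B\<close> with \<open>j < i\<close>, and every common
  index contributes the square \<open>-1\<close>.
\<close>

definition cl_sign :: "'n::{finite,linorder} set \<Rightarrow> 'n set \<Rightarrow> real" where
  "cl_sign A B = (\<Prod>i\<in>A. \<Prod>j\<in>B. if j \<le> i then -1 else 1)"

definition cl_mult :: "'n::{finite,linorder} cliff \<Rightarrow> 'n cliff \<Rightarrow> 'n cliff" (infixl "\<odot>" 70) where
  "a \<odot> b = (\<Sum>A\<in>UNIV. \<Sum>B\<in>UNIV. (a $ A * b $ B * cl_sign A B) *\<^sub>R cl_basis (sym_diff A B))"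

text \<open>The next facts confirm that this is the intended algebra.\<close>

lemma cl_mult_basis:
  "cl_basis A \<odot> cl_basis B = cl_sign A B *\<^sub>R cl_basis (sym_diff A B)"
proof -
  have "cl_basis A \<odot> cl_basis B = (\<Sum>A'\<in>UNIV. \<Sum>B'\<in>UNIV.
      if A' = A then if B' = B then cl_sign A B *\<^sub>R cl_basis (sym_diff A B) else 0 else 0)"
    unfolding cl_mult_def by (intro sum.cong refl) (auto simp: cl_basis_def axis_def)
  also have "\<dots> = (\<Sum>A'\<in>UNIV. if A' = A then cl_sign A B *\<^sub>R cl_basis (sym_diff A B) else 0)"
    by (intro sum.cong refl) auto
  finally show ?thesis by simp
qed

lemma bilinear_cl_mult: "bilinear (\<odot>)"
  unfolding bilinear_def cl_mult_def
  by (auto intro!: linearI simp: sum.distrib[symmetric] scaleR_sum_right algebra_simps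
      scaleR_add_left[symmetric] simp del: scaleR_add_left)

lemma cl_expand: "a = (\<Sum>A\<in>UNIV. a $ A *\<^sub>R cl_basis A)"
  by (simp add: vec_eq_iff cl_basis_def axis_def if_distrib cong: if_cong)

lemma cl_linear: "linear (\<lambda>x. x \<odot> y)" "linear (\<lambda>x. y \<odot> x)"
  using bilinear_cl_mult by (auto simp: bilinear_def)

lemma cl_linear_eqI:
  assumes "linear f" and "linear g" and "\<And>A. f (cl_basis A) = g (cl_basis A)"
  shows "f a = g a"
proof (rule linear_eq_on_span[OF assms(1,2)])
  show "a \<in> span (range cl_basis)"
    by (subst cl_expand) (intro span_sum span_scale span_base rangeI)
qed (use assms(3) in auto)

lemma cl_mult_one: "cl_one \<odot> a = a" "a \<odot> cl_one = a"
proof -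
  have id: "linear (\<lambda>x :: 'a cliff. x)"
    by (rule linear_ident)
  show "cl_one \<odot> a = a"
    by (rule cl_linear_eqI[OF cl_linear(2) id]) (simp add: cl_mult_basis cl_sign_def)
  show "a \<odot> cl_one = a"
    by (rule cl_linear_eqI[OF cl_linear(1) id]) (simp add: cl_mult_basis cl_sign_def)
qed

lemma cl_gen_relations:
  "cl_gen r \<odot> cl_gen s + cl_gen s \<odot> cl_gen r = (if r = s then -2 else 0) *\<^sub>R cl_one"
  by (cases r s rule: linorder_cases)
     (auto simp: cl_mult_basis cl_sign_def insert_Diff_if insert_commute vec_eq_iff)

lemma cl_basis_insert:
  assumes "\<And>j. j \<in> A \<Longrightarrow> i < j"
  shows "cl_basis (insert i A) = cl_gen i \<odot> cl_basis A"
proof -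
  have "(if j \<le> i then -1 else 1) = (1::real)" if "j \<in> A" for j
    using assms[OF that] by auto
  then have "cl_sign {i} A = 1"
    by (simp add: cl_sign_def)
  moreover have "({i} - A) \<union> (A - {i}) = insert i A"
    using assms by auto
  ultimately show ?thesis by (simp add: cl_mult_basis)
qed

lemma prod_sym_diff:
  fixes f :: "'n::finite \<Rightarrow> real"
  assumes "\<And>i. f i * f i = 1"
  shows "prod f (sym_diff A B) = prod f A * prod f B"
proof -
  have A: "prod f A = prod f (A - B) * prod f (A \<inter> B)"
    using prod.Int_Diff[of A f B] by simp
  have B: "prod f B = prod f (B - A) * prod f (A \<inter> B)"
    using prod.Int_Diff[of B f A] by (simp add: Int_commute)
  have "prod f (A \<inter> B) * prod f (A \<inter> B) = 1"
    using assms by (simp flip: prod.distrib)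
  moreover have "prod f (sym_diff A B) = prod f (A - B) * prod f (B - A)"
    by (rule prod.union_disjoint) auto
  ultimately show ?thesis
    unfolding A B by (simp add: algebra_simps)
qed

lemma cl_sign_sym_diff:
  "cl_sign (sym_diff A B) C = cl_sign A C * cl_sign B C"
  "cl_sign A (sym_diff B C) = cl_sign A B * cl_sign A C"
proof -
  show "cl_sign (sym_diff A B) C = cl_sign A C * cl_sign B C"
    unfolding cl_sign_def by (rule prod_sym_diff) (simp flip: prod.distrib add: if_distrib cong: if_cong)
  show "cl_sign A (sym_diff B C) = cl_sign A B * cl_sign A C"
    unfolding cl_sign_def prod.distrib[symmetric]
    by (intro prod.cong refl prod_sym_diff) simp
qed

lemma cl_mult_assoc: "(a \<odot> b) \<odot> c = a \<odot> (b \<odot> c)"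
proof -
  have basis: "(cl_basis A \<odot> cl_basis B) \<odot> cl_basis C = cl_basis A \<odot> (cl_basis B \<odot> cl_basis C)"
    for A B C :: "'a set"
  proof -
    have "((A - B \<union> (B - A)) - C) \<union> (C - (A - B \<union> (B - A)))
        = (A - (B - C \<union> (C - B))) \<union> ((B - C \<union> (C - B)) - A)"
      by auto
    then show ?thesis
      by (simp add: cl_mult_basis bilinear_lmul[OF bilinear_cl_mult]
          bilinear_rmul[OF bilinear_cl_mult] cl_sign_sym_diff)
  qed
  have 1: "(cl_basis A \<odot> cl_basis B) \<odot> c = cl_basis A \<odot> (cl_basis B \<odot> c)" for A B
    by (rule cl_linear_eqI[OF cl_linear(2) linear_compose[OF cl_linear(2) cl_linear(2), unfolded o_def]]) (auto simp: basis)
  have 2: "(cl_basis A \<odot> b) \<odot> c = cl_basis A \<odot> (b \<odot> c)" for A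
    by (rule cl_linear_eqI[OF linear_compose[OF cl_linear(2) cl_linear(1), unfolded o_def]
          linear_compose[OF cl_linear(1) cl_linear(2), unfolded o_def]]) (auto simp: 1)
  show ?thesis
    by (rule cl_linear_eqI[OF linear_compose[OF cl_linear(1) cl_linear(1), unfolded o_def] cl_linear(1)]) (auto simp: 2)
qed

section \<open>Paravectors and slices\<close>

text \<open>
  The paravector with real part \<open>x0\<close> and coordinates \<open>x\<close> is the pair \<open>(x0, x)\<close>; the product norm is
  the Euclidean norm on \<open>(n+1)\<close>-space.
\<close>

type_synonym 'n paravec = "real \<times> (real, 'n) vec"

definition cl_vec :: "real ^ 'n::finite \<Rightarrow> 'n cliff" where
  "cl_vec x = (\<Sum>i\<in>UNIV. x $ i *\<^sub>R cl_gen i)"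

definition imag_units :: "(real ^ 'n::finite) set" where
  "imag_units = {I. (\<Sum>i\<in>UNIV. (I $ i)\<^sup>2) = 1}"

lemma cl_vec_square:
  assumes "I \<in> imag_units" shows "cl_vec I \<odot> cl_vec I = - (cl_one)"
proof -
  let ?S = "cl_vec I \<odot> cl_vec I"
  have e: "?S = (\<Sum>i\<in>UNIV. \<Sum>j\<in>UNIV. (I $ i * I $ j) *\<^sub>R (cl_gen i \<odot> cl_gen j))"
    unfolding cl_vec_def bilinear_sum[OF bilinear_cl_mult] sum.cartesian_product
    by (simp add: bilinear_lmul[OF bilinear_cl_mult] bilinear_rmul[OF bilinear_cl_mult]
        case_prod_beta mult.commute)
  have e': "?S = (\<Sum>i\<in>UNIV. \<Sum>j\<in>UNIV. (I $ i * I $ j) *\<^sub>R (cl_gen j \<odot> cl_gen i))"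
    unfolding e by (subst sum.swap) (simp add: mult.commute)
  have "?S + ?S =
      (\<Sum>i\<in>UNIV. \<Sum>j\<in>UNIV. (I $ i * I $ j) *\<^sub>R (cl_gen i \<odot> cl_gen j + cl_gen j \<odot> cl_gen i))"
    by (subst e, subst e') (simp add: sum.distrib scaleR_add_right)
  also have "\<dots> = (\<Sum>i\<in>UNIV. \<Sum>j\<in>UNIV. if i = j then (-2 * (I$i)^2) *\<^sub>R cl_one else 0)"
    unfolding cl_gen_relations by (intro sum.cong refl) (auto simp: power2_eq_square)
  also have "\<dots> = (\<Sum>i\<in>UNIV. (-2 * (I$i)^2)) *\<^sub>R cl_one"
    by (simp add: scaleR_sum_left)
  also have "(\<Sum>i\<in>UNIV. (-2 * (I$i)^2)) = -2"
    using assms by (simp add: imag_units_def sum_negf flip: sum_distrib_left)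
  finally have "2 *\<^sub>R ?S = 2 *\<^sub>R (- (cl_one))" by (simp add: scaleR_2[symmetric])
  then show ?thesis unfolding scaleR_cancel_left by simp
qed

text \<open>The paravector \<open>u + I v\<close>.\<close>

definition slice_pt :: "real ^ 'n::finite \<Rightarrow> real \<Rightarrow> real \<Rightarrow> 'n paravec" where
  "slice_pt I u v = (u, v *\<^sub>R I)"

text \<open>The identification of \<open>\<complex>\<close> with the plane \<open>L\<^sub>I\<close> inside the Clifford algebra.\<close>

definition cl_complex :: "real ^ 'n::finite \<Rightarrow> complex \<Rightarrow> 'n cliff" where
  "cl_complex I z = Re z *\<^sub>R cl_one + Im z *\<^sub>R cl_vec I"

definition half_space :: "'n::finite paravec set" where
  "half_space = {slice_pt I u v | I u v. I \<in> imag_units \<and> u > 0}"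

text \<open>Meant for open \<open>U\<close>.\<close>

definition slice_monogenic :: "'n::{finite,linorder} paravec set \<Rightarrow> ('n paravec \<Rightarrow> 'n cliff) set" where
  "slice_monogenic U = {f. (\<forall>x\<in>U. f differentiable (at x)) \<and>
     (\<forall>I\<in>imag_units. \<forall>u v. slice_pt I u v \<in> U \<longrightarrow>
        (1/2) *\<^sub>R (vector_derivative (\<lambda>s. f (slice_pt I s v)) (at u)
          + cl_vec I \<odot> vector_derivative (\<lambda>t. f (slice_pt I u t)) (at v)) = 0)}"

section \<open>Extension from a boundary line\<close>

text \<open>
  The kernel is a function on \<open>L\<^sub>I\<close>, computed here in \<open>\<complex>\<close>. For \<open>u > 0\<close> the value at \<open>2u\<close> is a
  real number.
\<close>

definition szego_kernel :: "complex \<Rightarrow> complex" where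
  "szego_kernel z = 1 / (2 * of_real pi) * (LINT w:{..0}|lebesgue. exp (z * of_real w))"

definition poisson_kernel :: "real \<Rightarrow> real \<Rightarrow> real" where
  "poisson_kernel u v = (cmod (szego_kernel (Complex u v)))\<^sup>2 / Re (szego_kernel (of_real (2 * u)))"

text \<open>
  The values of \<open>f\<close> on the half space are those determined by its values on the line \<open>I\<real>\<close>.
\<close>

definition poisson_extended :: "real ^ 'n::{finite,linorder} \<Rightarrow> ('n paravec \<Rightarrow> 'n cliff) \<Rightarrow> bool" where
  "poisson_extended I f \<longleftrightarrow>
     (\<forall>u>0. \<forall>v. f (slice_pt I u v) =
        (LINT w|lebesgue. poisson_kernel u (v - w) *\<^sub>R f (slice_pt I 0 w))) \<and>
     (\<forall>J\<in>imag_units. \<forall>u>0. \<forall>v. f (slice_pt J u v) =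
        (1/2) *\<^sub>R (f (slice_pt I u (-v)) + f (slice_pt I u v))
        + (1/2) *\<^sub>R (cl_vec J \<odot> cl_vec I \<odot> (f (slice_pt I u (-v)) - f (slice_pt I u v))))"

lemma cl_vec_neg: "cl_vec (-I) = - cl_vec I"
  by (simp add: cl_vec_def sum_negf)

text \<open>
  The two clauses are compatible, also where \<open>J = I\<close>, \<open>J = -I\<close> and on the real axis.
\<close>

lemma poisson_extended_exists:
  fixes g :: "real \<Rightarrow> 'n::{finite,linorder} cliff"
  assumes I: "I \<in> imag_units"
  shows "\<exists>f. (\<forall>v. f (slice_pt I 0 v) = g v) \<and> poisson_extended I f"
proof -
  have imag: "y \<in> imag_units \<longleftrightarrow> norm y = 1" for y :: "(real, 'n) vec"
      unfolding imag_units_def norm_vec_def L2_set_def by simp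
  define P where "P u v = (LINT w|lebesgue. poisson_kernel u (v - w) *\<^sub>R g w)" for u v
  define E where "E J u v = (1/2) *\<^sub>R (P u (-v) + P u v)
        + (1/2) *\<^sub>R (cl_vec J \<odot> cl_vec I \<odot> (P u (-v) - P u v))" for J u v
  define f where "f x = (if fst x > 0 then E (sgn (snd x)) (fst x) (norm (snd x)) else g (snd x \<bullet> I))" for x
  have II: "I \<bullet> I = 1" using I by (simp add: imag dot_square_norm)
  have b: "f (slice_pt I 0 v) = g v" for v by (simp add: f_def slice_pt_def II)
  note bil = bilinear_lneg[OF bilinear_cl_mult] bilinear_rneg[OF bilinear_cl_mult]
    bilinear_lzero[OF bilinear_cl_mult] bilinear_rzero[OF bilinear_cl_mult]
    bilinear_rsub[OF bilinear_cl_mult]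
  have E: "f (slice_pt J u v) = E J u v" if J: "J \<in> imag_units" and u: "u > 0" for J u v
  proof -
    consider "v = 0" | "v > 0" | "v < 0" by linarith
    then show ?thesis
    proof cases
      case 1
      then show ?thesis using u by (simp add: f_def slice_pt_def E_def bil)
    next
      case 2
      then have "sgn (v *\<^sub>R J) = J" "norm (v *\<^sub>R J) = v"
        using J by (auto simp: imag sgn_scaleR sgn_div_norm)
      then show ?thesis using u by (simp add: f_def slice_pt_def)
    next
      case 3
      then have "sgn (v *\<^sub>R J) = -J" "norm (v *\<^sub>R J) = -v"
        using J by (auto simp: imag sgn_scaleR sgn_div_norm)
      then show ?thesis using u by (simp add: f_def slice_pt_def E_def cl_vec_neg bil algebra_simps)
    qed
  qed
  have EI: "E I u v = P u v" for u v
    unfolding E_def cl_vec_square[OF I] bil cl_mult_one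
    by (simp add: scaleR_add_left[symmetric] algebra_simps)
  have "poisson_extended I f"
    unfolding poisson_extended_def b using E E[OF I] EI P_def E_def by simp
  then show ?thesis using b by blast
qed

section \<open>Lebesgue spaces and the Fourier transform\<close>

definition Lp :: "real \<Rightarrow> (real \<Rightarrow> 'b::euclidean_space) set" where
  "Lp p = {g. g \<in> borel_measurable lebesgue \<and> integrable lebesgue (\<lambda>v. norm (g v) powr p)}"

definition Lp_converges :: "real \<Rightarrow> (nat \<Rightarrow> real \<Rightarrow> 'b::euclidean_space) \<Rightarrow> (real \<Rightarrow> 'b) \<Rightarrow> bool" where
  "Lp_converges p g h \<longleftrightarrow>
     (\<lambda>k. \<integral>\<^sup>+v. ennreal (norm (g k v - h v) powr p) \<partial>lebesgue) \<longlonglongrightarrow> 0"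

definition cl_fourier_L1 ::
  "real ^ 'n::{finite,linorder} \<Rightarrow> (real \<Rightarrow> 'n cliff) \<Rightarrow> real \<Rightarrow> 'n cliff" where
  "cl_fourier_L1 I g w =
     (1 / sqrt (2 * pi)) *\<^sub>R (LINT v|lebesgue. cl_complex I (exp (- (\<i> * of_real (v * w)))) \<odot> g v)"

text \<open>
  \<open>h\<close> is the Fourier transform of \<open>g \<in> L\<^sup>p\<close>: for \<open>p > 1\<close> the transform is the continuous extension
  from \<open>L\<^sup>1 \<inter> L\<^sup>p\<close>, as a map into \<open>L\<^sup>q\<close> with \<open>q = p / (p - 1)\<close>. By the Hausdorff-Young inequality
  such an \<open>h\<close> exists, is unique almost everywhere and does not depend on the approximating sequence.
\<close>

definition has_cl_fourier ::
  "real \<Rightarrow> real ^ 'n::{finite,linorder} \<Rightarrow> (real \<Rightarrow> 'n cliff) \<Rightarrow> (real \<Rightarrow> 'n cliff) \<Rightarrow> bool" where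
  "has_cl_fourier p I g h \<longleftrightarrow>
     (if p = 1 then h = cl_fourier_L1 I g
      else h \<in> Lp (p / (p - 1)) \<and>
        (\<exists>a. (\<forall>k. a k \<in> Lp 1 \<inter> Lp p) \<and> Lp_converges p a g \<and>
             Lp_converges (p / (p - 1)) (\<lambda>k. cl_fourier_L1 I (a k)) h))"

text \<open>The support of an almost-everywhere class of functions.\<close>

definition ess_support :: "(real \<Rightarrow> 'b::real_vector) \<Rightarrow> real set" where
  "ess_support h = - \<Union>{U. open U \<and> (AE w in lebesgue. w \<in> U \<longrightarrow> h w = 0)}"

section \<open>The slice Hardy space of the half space\<close>

definition nontangential_limit ::
  "('n::finite paravec \<Rightarrow> 'n cliff) \<Rightarrow> real ^ 'n \<Rightarrow> real \<Rightarrow> 'n cliff \<Rightarrow> bool" where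
  "nontangential_limit f J v0 l \<longleftrightarrow>
     (\<forall>\<alpha>>0. ((\<lambda>(u, v). f (slice_pt J u v)) \<longlongrightarrow> l)
        (at (0, v0) within {(u, v). u > 0 \<and> \<bar>v - v0\<bar> < \<alpha> * u}))"

text \<open>
  \<open>F J\<close> is the boundary function of \<open>f\<close> on the line \<open>J\<real>\<close>; it is determined, and Lebesgue
  measurable, up to a null set.
\<close>

definition Hp_slice :: "real \<Rightarrow> ('n::{finite,linorder} paravec \<Rightarrow> 'n cliff) set" where
  "Hp_slice p = {f \<in> slice_monogenic half_space.
     \<exists>F. (\<forall>J\<in>imag_units. AE v in lebesgue. nontangential_limit f J v (F J v)) \<and>
         (SUP J\<in>imag_units. \<integral>\<^sup>+v. ennreal (norm (F J v) powr p) \<partial>lebesgue) < \<infinity>}"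

end

theory Submission
  imports Defs "HOL-Real_Asymp.Real_Asymp"
begin

text \<open>
  Write \<open>g v = f (I v)\<close> for the boundary function. Left multiplication by \<open>u + I v\<close> makes the
  Clifford algebra a complex vector space (\<open>cl_act\<close>), and in the plane \<open>L\<^sub>I\<close> the theorem is
  classical: with \<open>z = u + i v\<close>, the Poisson kernel is \<open>1 / (2 \<pi>)\<close> times the sum of the Cauchy
  kernel \<open>1 / (z - i w)\<close> and its conjugate \<open>1 / (cnj z + i w)\<close>. The conjugate kernel is the
  superposition of \<open>exp (- cnj z x) exp (- i w x)\<close> over the frequencies \<open>x > 0\<close>, so its integral
  against \<open>g\<close> is a Laplace transform of the positive half of the spectrum and vanishes by
  hypothesis (\<open>conjugate_cauchy_integral_eq_0\<close>; for \<open>p > 1\<close> one passes to the limit along the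
  sequence that defines the Fourier transform). What remains of \<open>f\<close> on \<open>L\<^sub>I\<close> is a Cauchy integral,
  and that is holomorphic (\<open>cauchy_integral_has_derivative\<close>).

  The extension to the other slices has the form \<open>f (u + J v) = A z + J B z\<close> with \<open>A\<close> and \<open>B\<close>
  independent of \<open>J\<close> and satisfying the Cauchy-Riemann equations. These equations give slice
  monogenicity on every slice. On the real axis, where the direction \<open>J\<close> is undefined, \<open>B\<close>
  vanishes, and this is what makes \<open>f\<close> differentiable there as a function of \<open>n + 1\<close> real
  variables (\<open>slice_monogenic_of_stem\<close>).

  Boundary values come from Fatou's theorem: at every Lebesgue point of \<open>g\<close> the Poisson integral
  converges non-tangentially to \<open>g\<close> (\<open>poisson_integral_nontangential_limit\<close>), and almost every
  point is a Lebesgue point (\<open>AE_lebesgue_point\<close>). On the slice of \<open>J\<close> the boundary function is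
  therefore the same combination of \<open>g v\<close> and \<open>g (- v)\<close> as in the extension formula. As \<open>J\<close> ranges
  over the unit sphere its norm is at most a constant times \<open>\<bar>g v\<bar> + \<bar>g (- v)\<bar>\<close>, which bounds the
  \<open>L\<^sup>p\<close> norms uniformly.
\<close>

section \<open>Lebesgue points on the line\<close>

text \<open>
  The one-sided core of the differentiation theorem. The measure \<open>\<nu>\<close> with density \<open>j\<close> does not
  charge the zero set of \<open>j\<close>, so outer regularity encloses that set in an open \<open>U\<close> with \<open>\<nu> U\<close> as
  small as desired. Points with large averages are covered by balls in \<open>U\<close> on which \<open>\<nu>\<close> exceeds a
  fixed multiple of length; a disjoint Vitali subfamily shows that their total length is small.
\<close>

lemma small_averages_at_zeros:
  fixes j :: "real \<Rightarrow> ennreal"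
  assumes meas [measurable]: "j \<in> borel_measurable borel"
    and fin: "\<And>N::nat. (\<integral>\<^sup>+x\<in>ball 0 (real N). j x \<partial>lborel) < \<infinity>"
  shows "AE x in lborel. j x = 0 \<longrightarrow>
    (\<forall>e>0. \<exists>d>0. \<forall>r. 0 < r \<longrightarrow> r < d \<longrightarrow> (\<integral>\<^sup>+y\<in>ball x r. j y \<partial>lborel) \<le> ennreal (e * r))"
proof -
  have [measurable]: "ball x r \<in> sets borel" for x r :: real by simp
  have two: "2 * ennreal x = ennreal (2 * x)" if "x \<ge> 0" for x
    using ennreal_mult[of 2 x] that by simp
  define avg where "avg x r = (\<integral>\<^sup>+y\<in>ball x r. j y \<partial>lborel)" for x r
  define bad where "bad e N = {x \<in> ball 0 (real N). j x = 0 \<and>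
      (\<forall>d>0. \<exists>r. 0 < r \<and> r < d \<and> avg x r > ennreal (e * r))}" for e and N :: nat
  have neg: "negligible (bad e N)" if e: "e > 0" for e N
    unfolding negligible_outer_le
  proof (intro allI impI)
    fix \<epsilon> :: real assume \<epsilon>: "\<epsilon> > 0"
    define \<nu> where "\<nu> = density lborel (\<lambda>x. j x * indicator (ball 0 (real N)) x)"
    have \<nu>: "emeasure \<nu> B = (\<integral>\<^sup>+x\<in>B. (j x * indicator (ball 0 (real N)) x) \<partial>lborel)" if "B \<in> sets borel" for B
    proof -
      have "(\<lambda>x. j x * indicator (ball 0 (real N)) x) \<in> borel_measurable lborel" by measurable
      then show ?thesis unfolding \<nu>_def using that by (simp add: emeasure_density)
    qed
    define Z where "Z = {x \<in> ball 0 (real N). j x = 0}"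
    have Z: "Z \<in> sets borel" unfolding Z_def by measurable
    have "emeasure \<nu> Z = 0"
      unfolding \<nu>[OF Z] by (subst nn_integral_0_iff_AE) (measurable, auto simp: Z_def indicator_def)
    moreover have "emeasure \<nu> Z = (INF U\<in>{U. Z \<subseteq> U \<and> open U}. emeasure \<nu> U)"
    proof (rule outer_regular)
      show "sets \<nu> = sets borel" by (simp add: \<nu>_def)
      show "emeasure \<nu> (space \<nu>) \<noteq> \<infinity>"
        using fin[of N] by (simp add: \<nu> \<nu>_def[THEN arg_cong[of _ _ space]])
    qed (rule Z)
    ultimately have "(INF U\<in>{U. Z \<subseteq> U \<and> open U}. emeasure \<nu> U) < ennreal (e * \<epsilon> / 2)"
      using e \<epsilon> by (metis ennreal_less_zero_iff half_gt_zero mult_pos_pos)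
    then obtain U where U: "Z \<subseteq> U" "open U" and \<nu>U: "emeasure \<nu> U < ennreal (e * \<epsilon> / 2)"
      by (auto simp: INF_less_iff)
    define K where "K = {(x, r). 0 < r \<and> ball x r \<subseteq> U \<inter> ball 0 (real N) \<and> avg x r > ennreal (e * r)}"
    have cover: "\<exists>i\<in>K. x \<in> ball (fst i) (snd i) \<and> snd i < d" if "x \<in> bad e N" "d > 0" for x d
    proof -
      have "x \<in> U \<inter> ball 0 (real N)" using that U by (auto simp: bad_def Z_def)
      moreover have "open (U \<inter> ball 0 (real N))" using U by auto
      ultimately obtain s where s: "s > 0" "ball x s \<subseteq> U \<inter> ball 0 (real N)"
        by (meson openE)
      have "min s d > 0" using s that by simp
      moreover have "\<forall>d>0. \<exists>r. 0 < r \<and> r < d \<and> avg x r > ennreal (e * r)"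
        using that(1) unfolding bad_def by simp
      ultimately obtain r where r: "0 < r" "r < min s d" "avg x r > ennreal (e * r)" by metis
      have "ball x r \<subseteq> U \<inter> ball 0 (real N)"
        using s(2) r(2) subset_ball[of r s x] by auto
      then have "(x, r) \<in> K" using r by (auto simp: K_def)
      then show ?thesis using r by force
    qed
    obtain C where C: "countable C" "C \<subseteq> K"
      and disj: "pairwise (\<lambda>i j. disjnt (ball (fst i) (snd i)) (ball (fst j) (snd j))) C"
      and rest: "negligible (bad e N - (\<Union>i\<in>C. ball (fst i) (snd i)))"
      by (rule Vitali_covering_theorem_balls[of "bad e N" K fst snd]) (use cover in blast)+
    define W where "W = (\<Union>i\<in>C. ball (fst i) (snd i))"
    have W: "W \<in> sets borel" unfolding W_def using C by (intro sets.countable_UN') auto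
    have djf: "disjoint_family_on (\<lambda>i. ball (fst i) (snd i)) C"
      using disj by (auto simp: disjoint_family_on_def pairwise_def disjnt_def)
    have le: "ennreal e * emeasure lborel (ball (fst i) (snd i)) \<le> 2 * emeasure \<nu> (ball (fst i) (snd i))"
      if "i \<in> C" for i
    proof -
      obtain x r where i: "i = (x, r)" by (cases i)
      have K: "0 < r" "ball x r \<subseteq> U \<inter> ball 0 (real N)" "avg x r > ennreal (e * r)"
        using subsetD[OF C(2) that] unfolding K_def i by simp_all
      have "emeasure \<nu> (ball x r) = avg x r"
        unfolding avg_def by (subst \<nu>, simp, intro nn_integral_cong) (use K in \<open>auto simp: indicator_def\<close>)
      moreover have "ennreal e * emeasure lborel (ball x r) = 2 * ennreal (e * r)"
      proof -
        have "emeasure lborel (ball x r) = ennreal (2 * r)"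
          using K(1) by (simp add: ball_eq_greaterThanLessThan)
        moreover have "ennreal e * ennreal (2 * r) = ennreal (2 * (e * r))"
          using K e by (simp add: ennreal_mult[symmetric] mult_ac)
        ultimately show ?thesis using two[of "e * r"] K e by simp
      qed
      ultimately show ?thesis using K(3) i by (simp add: mult_left_mono)
    qed
    have "ennreal e * emeasure lborel W =
        (\<integral>\<^sup>+i. ennreal e * emeasure lborel (ball (fst i) (snd i)) \<partial>count_space C)"
      unfolding W_def using C djf by (subst emeasure_UN_countable) (auto simp: nn_integral_cmult)
    also have "\<dots> \<le> (\<integral>\<^sup>+i. 2 * emeasure \<nu> (ball (fst i) (snd i)) \<partial>count_space C)"
      by (rule nn_integral_mono) (use le in auto)
    also have "\<dots> = 2 * emeasure \<nu> W"
      unfolding W_def using C djf by (subst emeasure_UN_countable) (auto simp: nn_integral_cmult \<nu>_def)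
    also have "emeasure \<nu> W \<le> emeasure \<nu> U"
    proof (rule emeasure_mono)
      have "ball (fst i) (snd i) \<subseteq> U" if "i \<in> C" for i
        using subsetD[OF C(2) that] unfolding K_def case_prod_beta by blast
      then show "W \<subseteq> U" unfolding W_def by blast
      show "U \<in> sets \<nu>" using U(2) by (simp add: \<nu>_def)
    qed
    finally have "ennreal e * emeasure lborel W \<le> 2 * emeasure \<nu> U" by (simp add: mult_left_mono)
    also have "\<dots> \<le> 2 * ennreal (e * \<epsilon> / 2)" using \<nu>U by (intro mult_left_mono) auto
    also have "\<dots> = ennreal e * ennreal \<epsilon>"
      using e \<epsilon> two[of "e * \<epsilon> / 2"] by (simp add: ennreal_mult)
    finally have *: "emeasure lborel W \<le> ennreal \<epsilon>"
      using e by (simp add: ennreal_mult_le_mult_iff)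
    then have "W \<in> lmeasurable" using W
      by (intro fmeasurableI) (auto simp: less_top[symmetric] top_unique)
    moreover have "measure lebesgue W \<le> \<epsilon>"
      using * W \<epsilon> by (simp add: measure_def enn2real_leI)
    ultimately have "W \<union> (bad e N - W) \<in> lmeasurable"
        and "measure lebesgue (W \<union> (bad e N - W)) \<le> measure lebesgue W + measure lebesgue (bad e N - W)"
      using fmeasurable.Un[OF _ negligible_imp_measurable[OF rest[folded W_def]]]
        measure_Un_le[OF fmeasurableD fmeasurableD[OF negligible_imp_measurable[OF rest[folded W_def]]]]
      by metis+
    then have "bad e N \<subseteq> W \<union> (bad e N - W) \<and> W \<union> (bad e N - W) \<in> lmeasurable
        \<and> measure lebesgue (W \<union> (bad e N - W)) \<le> \<epsilon>"
      using \<open>measure lebesgue W \<le> \<epsilon>\<close> negligible_imp_measure0[OF rest[folded W_def]] by auto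
    then show "\<exists>T. bad e N \<subseteq> T \<and> T \<in> lmeasurable \<and> measure lebesgue T \<le> \<epsilon>" by blast
  qed
  have "negligible (\<Union>(k, N). bad (inverse (real (Suc k))) N)"
    by (rule negligible_countable_Union) (use neg in auto)
  then have "AE x in lebesgue. x \<notin> (\<Union>(k, N). bad (inverse (real (Suc k))) N)"
    unfolding negligible_iff_null_sets by (rule AE_not_in)
  then have "AE x in lborel. x \<notin> (\<Union>(k, N). bad (inverse (real (Suc k))) N)"
    by (simp only: AE_completion_iff)
  then show ?thesis
  proof (eventually_elim, intro impI allI)
    fix x e :: real
    assume nb: "x \<notin> (\<Union>(k, N). bad (inverse (real (Suc k))) N)" and z: "j x = 0" and e: "0 < e"
    obtain k where k: "inverse (real (Suc k)) < e" using reals_Archimedean[OF e] by blast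
    obtain N :: nat where N: "norm x < real N" using reals_Archimedean2 by blast
    have "x \<notin> bad (inverse (real (Suc k))) N" using nb by auto
    then have "\<not> (\<forall>d>0. \<exists>r. 0 < r \<and> r < d \<and> avg x r > ennreal (inverse (real (Suc k)) * r))"
      using z N unfolding bad_def by simp
    then obtain d where d: "d > 0" "\<And>r. 0 < r \<Longrightarrow> r < d \<Longrightarrow> avg x r \<le> ennreal (inverse (real (Suc k)) * r)"
      by (meson not_less)
    show "\<exists>d>0. \<forall>r. 0 < r \<longrightarrow> r < d \<longrightarrow> (\<integral>\<^sup>+y\<in>ball x r. j y \<partial>lborel) \<le> ennreal (e * r)"
    proof (intro exI conjI allI impI)
      fix r assume r: "0 < r" "r < d"
      then show "(\<integral>\<^sup>+y\<in>ball x r. j y \<partial>lborel) \<le> ennreal (e * r)"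
        using d(2)[OF r] k unfolding avg_def
        by (elim order_trans) (intro ennreal_leI mult_right_mono, auto)
    qed (rule d)
  qed
qed
lemma lebesgue_measurable_ae_borel:
  fixes g :: "real \<Rightarrow> 'b::euclidean_space"
  assumes g: "g \<in> borel_measurable lebesgue"
  obtains g' where "g' \<in> borel_measurable borel" "AE x in lborel. g x = g' x"
proof -
  have "\<exists>h. h \<in> borel_measurable lborel \<and> (AE x in lborel. g x \<bullet> b = h x)" if "b \<in> Basis" for b
    using completion_ex_borel_measurable_real[of "\<lambda>x. g x \<bullet> b" lborel] g by auto
  then obtain h where h: "\<And>b. b \<in> Basis \<Longrightarrow> h b \<in> borel_measurable lborel"
      "\<And>b. b \<in> Basis \<Longrightarrow> AE x in lborel. g x \<bullet> b = h b x"
    by metis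
  show thesis
  proof
    show "(\<lambda>x. \<Sum>b\<in>Basis. h b x *\<^sub>R b) \<in> borel_measurable borel"
      using h(1) by (intro borel_measurable_sum borel_measurable_scaleR) auto
    have "AE x in lborel. \<forall>b\<in>Basis. g x \<bullet> b = h b x"
      using h(2) by (subst AE_finite_all) auto
    then show "AE x in lborel. g x = (\<Sum>b\<in>Basis. h b x *\<^sub>R b)"
      by eventually_elim (metis (mono_tags, lifting) euclidean_representation sum.cong)
  qed
qed

text \<open>
  \<open>small_averages_at_zeros\<close> is applied to the functions \<open>max 0 (\<bar>g - q\<bar> - a)\<close> for countably many \<open>q\<close> and
  \<open>a\<close>. Such a function vanishes at \<open>x\<close> if \<open>q\<close> is within \<open>a\<close> of \<open>g x\<close>, and it differs from
  \<open>\<bar>g - g x\<bar>\<close> by at most \<open>2 a\<close>.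
\<close>

theorem AE_lebesgue_point:
  fixes g :: "real \<Rightarrow> 'b::euclidean_space"
  assumes g: "g \<in> borel_measurable lebesgue"
    and fin: "\<And>N::nat. (\<integral>\<^sup>+x\<in>ball 0 (real N). norm (g x) \<partial>lborel) < \<infinity>"
  shows "AE x in lborel. \<forall>e>0. \<exists>d>0. \<forall>r. 0 < r \<longrightarrow> r < d \<longrightarrow>
    (\<integral>\<^sup>+y\<in>ball x r. norm (g y - g x) \<partial>lborel) \<le> ennreal (e * r)"
proof -
  have [measurable]: "ball x r \<in> sets borel" for x r :: real by simp
  obtain g' where g' [measurable]: "g' \<in> borel_measurable borel" and ae: "AE x in lborel. g x = g' x"
    using lebesgue_measurable_ae_borel[OF g] .
  obtain Q :: "'b set" where Q: "countable Q" "\<And>U. open U \<Longrightarrow> U \<noteq> {} \<Longrightarrow> \<exists>q\<in>Q. q \<in> U"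
    by (rule countable_dense_setE) blast
  define j where "j q n y = ennreal (norm (g' y - q) - inverse (real (Suc n)))" for q n y
  have [measurable]: "j q n \<in> borel_measurable borel" for q n unfolding j_def by measurable
  have finj: "(\<integral>\<^sup>+x\<in>ball 0 (real N). j q n x \<partial>lborel) < \<infinity>" for q n and N :: nat
  proof -
    have "(\<integral>\<^sup>+x\<in>ball 0 (real N). j q n x \<partial>lborel) \<le>
        (\<integral>\<^sup>+x. ennreal (norm (g' x)) * indicator (ball 0 (real N)) x + ennreal (norm q) * indicator (ball 0 (real N)) x \<partial>lborel)"
    proof (intro nn_integral_mono)
      fix x
      have "norm (g' x - q) \<le> norm (g' x) + norm q" by (rule norm_triangle_ineq4)
      moreover have "inverse (1 + real n) \<ge> 0" by simp
      ultimately have "norm (g' x - q) - inverse (1 + real n) \<le> norm (g' x) + norm q" by linarith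
      then show "j q n x * indicator (ball 0 (real N)) x \<le> ennreal (norm (g' x)) * indicator (ball 0 (real N)) x + ennreal (norm q) * indicator (ball 0 (real N)) x"
        by (auto simp: j_def indicator_def ennreal_plus[symmetric] simp del: ennreal_plus intro!: ennreal_leI)
    qed
    also have "\<dots> = (\<integral>\<^sup>+x\<in>ball 0 (real N). norm (g' x) \<partial>lborel) + ennreal (norm q) * emeasure lborel (ball (0::real) (real N))"
      by (subst nn_integral_add, measurable) (simp add: nn_integral_cmult_indicator)
    also have "(\<integral>\<^sup>+x\<in>ball 0 (real N). norm (g' x) \<partial>lborel) = (\<integral>\<^sup>+x\<in>ball 0 (real N). norm (g x) \<partial>lborel)"
      by (rule nn_integral_cong_AE) (use ae in eventually_elim, simp)
    also have "\<dots> + ennreal (norm q) * emeasure lborel (ball (0::real) (real N)) < \<infinity>"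
      using fin[of N] emeasure_bounded_finite[of "ball (0::real) (real N)"] by (auto simp: ennreal_mult_less_top)
    finally show ?thesis .
  qed
  have "AE x in lborel. \<forall>q\<in>Q. \<forall>n. j q n x = 0 \<longrightarrow>
     (\<forall>e>0. \<exists>d>0. \<forall>r. 0 < r \<longrightarrow> r < d \<longrightarrow> (\<integral>\<^sup>+y\<in>ball x r. j q n y \<partial>lborel) \<le> ennreal (e * r))"
    unfolding AE_ball_countable[OF Q(1)] AE_all_countable
    using small_averages_at_zeros[of "j q n" for q n] finj by simp
  then show ?thesis
    using ae
  proof (eventually_elim, intro allI impI)
    fix x e :: real
    assume small: "\<forall>q\<in>Q. \<forall>n. j q n x = 0 \<longrightarrow>
     (\<forall>e>0. \<exists>d>0. \<forall>r. 0 < r \<longrightarrow> r < d \<longrightarrow> (\<integral>\<^sup>+y\<in>ball x r. j q n y \<partial>lborel) \<le> ennreal (e * r))"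
      and gx: "g x = g' x" and e: "0 < e"
    obtain n where n: "inverse (real (Suc n)) < e / 8" using reals_Archimedean[of "e / 8"] e by auto
    let ?a = "inverse (real (Suc n))"
    have a: "?a > 0" by simp
    \<comment> \<open>With this choice of \<open>q\<close> the truncated function vanishes at \<open>x\<close>, so its averages are small.\<close>
    obtain q where q: "q \<in> Q" "q \<in> ball (g' x) ?a"
      using Q(2)[of "ball (g' x) ?a"] a by auto
    have qx: "norm (g' x - q) < ?a" using q by (simp add: dist_norm)
    then have "j q n x = 0" by (simp add: j_def ennreal_neg)
    then obtain d where d: "d > 0" "\<And>r. 0 < r \<Longrightarrow> r < d \<Longrightarrow> (\<integral>\<^sup>+y\<in>ball x r. j q n y \<partial>lborel) \<le> ennreal (e / 4 * r)"
      using small q(1) e by (metis divide_pos_pos zero_less_numeral)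
    show "\<exists>d>0. \<forall>r. 0 < r \<longrightarrow> r < d \<longrightarrow> (\<integral>\<^sup>+y\<in>ball x r. norm (g y - g x) \<partial>lborel) \<le> ennreal (e * r)"
    proof (intro exI conjI allI impI)
      fix r assume r: "0 < r" "r < d"
      have "(\<integral>\<^sup>+y\<in>ball x r. norm (g y - g x) \<partial>lborel) = (\<integral>\<^sup>+y\<in>ball x r. norm (g' y - g' x) \<partial>lborel)"
        by (rule nn_integral_cong_AE) (use ae in eventually_elim, simp add: gx)
      also have "\<dots> \<le> (\<integral>\<^sup>+y. j q n y * indicator (ball x r) y + ennreal (2 * ?a) * indicator (ball x r) y \<partial>lborel)"
      proof (intro nn_integral_mono)
        fix y
        have "norm (g' y - g' x) \<le> norm (g' y - q) + norm (g' x - q)"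
          by (metis norm_minus_commute norm_triangle_sub dist_norm dist_triangle2)
        then have "norm (g' y - g' x) \<le> max 0 (norm (g' y - q) - ?a) + 2 * ?a" using qx by linarith
        then have "ennreal (norm (g' y - g' x)) \<le> ennreal (max 0 (norm (g' y - q) - ?a) + 2 * ?a)"
          by (rule ennreal_leI)
        also have "\<dots> = ennreal (max 0 (norm (g' y - q) - ?a)) + ennreal (2 * ?a)"
          by (rule ennreal_plus) auto
        also have "ennreal (max 0 (norm (g' y - q) - ?a)) = j q n y" by (simp add: j_def max_def ennreal_neg)
        finally show "ennreal (norm (g' y - g' x)) * indicator (ball x r) y \<le> j q n y * indicator (ball x r) y + ennreal (2 * ?a) * indicator (ball x r) y"
          by (auto simp: indicator_def)
      qed
      also have "\<dots> = (\<integral>\<^sup>+y\<in>ball x r. j q n y \<partial>lborel) + ennreal (2 * ?a) * emeasure lborel (ball x r)"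
        by (subst nn_integral_add, measurable) (simp add: nn_integral_cmult_indicator)
      also have "emeasure lborel (ball x r) = ennreal (2 * r)" using r by (simp add: ball_eq_greaterThanLessThan)
      also have "(\<integral>\<^sup>+y\<in>ball x r. j q n y \<partial>lborel) + ennreal (2 * ?a) * ennreal (2 * r)
          \<le> ennreal (e / 4 * r) + ennreal (2 * ?a) * ennreal (2 * r)"
        using d(2)[OF r] by (rule add_right_mono)
      also have "\<dots> = ennreal (e / 4 * r + 2 * ?a * (2 * r))"
        using r e a by (simp add: ennreal_mult[symmetric] ennreal_plus[symmetric] del: ennreal_plus)
      also have "\<dots> \<le> ennreal (e * r)"
      proof (rule ennreal_leI)
        have "2 * ?a * (2 * r) \<le> e / 2 * r" using n r by (simp add: mult_right_mono)
        moreover have "e * r > 0" using e r by simp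
        ultimately show "e / 4 * r + 2 * ?a * (2 * r) \<le> e * r" by linarith
      qed
      finally show "(\<integral>\<^sup>+y\<in>ball x r. norm (g y - g x) \<partial>lborel) \<le> ennreal (e * r)" .
    qed (rule d)
  qed
qed

section \<open>The Poisson kernel\<close>

lemma exp_decay_integral_real:
  assumes "u > (0::real)"
  shows "integrable lborel (\<lambda>x. indicator {0<..} x * exp (- (u * x)))" (is ?A)
    and "(LINT x|lborel. indicator {0<..} x * exp (- (u * x))) = 1 / u" (is ?B)
proof -
  have D: "DERIV (\<lambda>x. - exp (- (u * x)) / u) x :> exp (- (u * x))" for x
    using assms by (auto intro!: derivative_eq_intros)
  have lim0: "(((\<lambda>x. - exp (- (u * x)) / u) \<circ> real_of_ereal) \<longlongrightarrow> - 1 / u) (at_right (0::ereal))"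
    unfolding zero_ereal_def ereal_tendsto_simps
    using assms by (auto intro!: tendsto_eq_intros)
  have "filterlim (\<lambda>x. - (u * x)) at_bot at_top"
    using assms by (simp add: filterlim_uminus_at_bot filterlim_tendsto_pos_mult_at_top[OF tendsto_const] filterlim_ident)
  then have "((\<lambda>x. - exp (- (u * x)) / u) \<longlongrightarrow> - 0 / u) at_top"
    using assms by (intro tendsto_intros filterlim_compose[OF exp_at_bot]) auto
  then have lim1: "(((\<lambda>x. - exp (- (u * x)) / u) \<circ> real_of_ereal) \<longlongrightarrow> 0) (at_left \<infinity>)"
    unfolding ereal_tendsto_simps by simp
  have *: "set_integrable lborel (einterval 0 \<infinity>) (\<lambda>x. exp (- (u * x)))"
     "(LBINT x=0..\<infinity>. exp (- (u * x))) = 0 - (- 1 / u)"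
    by (rule interval_integral_FTC_nonneg[OF _ D _ _ lim0 lim1]; simp)+
  have e: "einterval 0 \<infinity> = {0<..}" by (simp add: zero_ereal_def)
  show ?A ?B using * by (simp_all add: e set_integrable_def interval_lebesgue_integral_def set_lebesgue_integral_def)
qed

lemma exp_decay_integral:
  fixes c :: complex
  assumes "Re c > 0"
  shows "integrable lborel (\<lambda>x. indicator {0<..} x *\<^sub>R exp (- (c * of_real x)))" (is ?A)
    and "(LINT x|lborel. indicator {0<..} x *\<^sub>R exp (- (c * of_real x))) = 1 / c" (is ?B)
proof -
  have c: "c \<noteq> 0" using assms by auto
  show A: ?A
    by (rule Bochner_Integration.integrable_bound[OF exp_decay_integral_real(1)[OF assms]])
       (auto simp: indicator_def)
  have D: "((\<lambda>x. - exp (- (c * of_real x)) / c) has_vector_derivative exp (- (c * of_real x))) (at x)" for x :: real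
    using c by (auto intro!: derivative_eq_intros has_vector_derivative_real_field)
  have lim0: "(((\<lambda>x::real. - exp (- (c * of_real x)) / c) \<circ> real_of_ereal) \<longlongrightarrow> - 1 / c) (at_right (0::ereal))"
    unfolding zero_ereal_def ereal_tendsto_simps
    using c by (auto intro!: tendsto_eq_intros)
  have "filterlim (\<lambda>x. - (Re c * x)) at_bot at_top"
    using assms by (simp add: filterlim_uminus_at_bot filterlim_tendsto_pos_mult_at_top[OF tendsto_const] filterlim_ident)
  then have "((\<lambda>x. norm (exp (- (c * of_real x)))) \<longlongrightarrow> 0) at_top"
    by (simp add: filterlim_compose[OF exp_at_bot])
  then have "((\<lambda>x::real. - exp (- (c * of_real x)) / c) \<longlongrightarrow> - 0 / c) at_top"
    unfolding tendsto_norm_zero_iff using c by (intro tendsto_intros) auto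
  then have lim1: "(((\<lambda>x::real. - exp (- (c * of_real x)) / c) \<circ> real_of_ereal) \<longlongrightarrow> 0) (at_left \<infinity>)"
    unfolding ereal_tendsto_simps by simp
  have e: "einterval 0 \<infinity> = {0<..}" by (simp add: zero_ereal_def)
  have "(LBINT x=0..\<infinity>. exp (- (c * of_real x))) = 0 - (- 1 / c)"
    by (rule interval_integral_FTC_integrable[OF _ D _ _ lim0 lim1])
       (use A in \<open>auto simp: e set_integrable_def intro!: continuous_intros\<close>)
  then show ?B by (simp add: e interval_lebesgue_integral_def set_lebesgue_integral_def)
qed

lemma szego_kernel_eq:
  assumes "Re z > 0"
  shows "szego_kernel z = 1 / (2 * of_real pi * z)"
proof -
  have "(LINT w:{..0}|lebesgue. exp (z * of_real w)) = (LINT w|lebesgue. indicator {..0} (-w) *\<^sub>R exp (z * of_real (-w)))"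
    unfolding set_lebesgue_integral_def
    using lebesgue_integral_real_affine[of "-1" "\<lambda>w. indicator {..0} w *\<^sub>R exp (z * of_real w)" 0] by simp
  also have "\<dots> = (LINT w|lborel. indicator {..0} (-w) *\<^sub>R exp (z * of_real (-w)))"
    by (rule integral_completion) simp
  also have "\<dots> = (LINT w|lborel. indicator {0<..} w *\<^sub>R exp (- (z * of_real w)))"
    by (rule integral_cong_AE) (use AE_lborel_singleton[of 0] in \<open>auto simp: indicator_def elim!: eventually_mono\<close>)
  also have "\<dots> = 1 / z" by (rule exp_decay_integral(2)[OF assms])
  finally show ?thesis by (simp add: szego_kernel_def)
qed

lemma poisson_kernel_eq:
  assumes "u > 0"
  shows "poisson_kernel u v = u / (pi * (u\<^sup>2 + v\<^sup>2))"
proof -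
  define s where "s = u\<^sup>2 + v\<^sup>2"
  have s: "s > 0" using assms by (simp add: s_def add_pos_nonneg)
  have "(cmod (Complex u v))\<^sup>2 = s" by (simp add: cmod_def s_def)
  then have K: "(cmod (szego_kernel (Complex u v)))\<^sup>2 = 1 / ((2 * pi)\<^sup>2 * s)"
    using assms by (simp add: szego_kernel_eq norm_divide norm_mult power_divide power_mult_distrib)
  have K2: "Re (szego_kernel (of_real (2 * u))) = 1 / (4 * pi * u)"
    using assms Re_complex_of_real[of "1 / (4 * pi * u)"] by (simp add: szego_kernel_eq)
  show ?thesis
    using assms s unfolding poisson_kernel_def s_def[symmetric] K K2
    by (simp add: field_simps power2_eq_square)
qed

lemma inverse_quadratic_integral:
  assumes "u > (0::real)"
  shows "integrable lebesgue (\<lambda>w. 1 / (u\<^sup>2 + (v - w)\<^sup>2))" (is ?A)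
    and "(LINT w|lebesgue. 1 / (u\<^sup>2 + (v - w)\<^sup>2)) = pi / u" (is ?B)
proof -
  have pos: "u\<^sup>2 + (v - w)\<^sup>2 > 0" for w using assms by (simp add: add_pos_nonneg)
  have nz: "u\<^sup>2 + (v - w)\<^sup>2 \<noteq> 0" for w
    using pos[of w] by (rule less_imp_neq[THEN not_sym])
  have cont: "isCont (\<lambda>w. 1 / (u\<^sup>2 + (v - w)\<^sup>2)) w" for w
    using nz by (intro continuous_intros) auto
  have D: "DERIV (\<lambda>w. arctan ((w - v) / u) / u) w :> 1 / (u\<^sup>2 + (v - w)\<^sup>2)" for w
  proof -
    have "DERIV (\<lambda>w. arctan ((w - v) / u) / u) w :> (1 / u) * inverse (1 + ((w - v) / u)\<^sup>2) / u"
      using assms by (auto intro!: derivative_eq_intros)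
    also have "(1 / u) * inverse (1 + ((w - v) / u)\<^sup>2) / u = 1 / (u\<^sup>2 + (v - w)\<^sup>2)"
    proof -
      have "u * u * (1 + ((w - v) / u)\<^sup>2) = u\<^sup>2 + (v - w)\<^sup>2"
        using assms by (simp add: field_simps power2_eq_square)
      then show ?thesis by (metis (no_types, opaque_lifting) divide_divide_eq_left divide_inverse mult.commute mult_1 times_divide_eq_right)
    qed
    finally show ?thesis .
  qed
  have "filterlim (\<lambda>w. (w - v) / u) at_top at_top" 
    using assms by real_asymp
  then have "((\<lambda>w. arctan ((w - v) / u) / u) \<longlongrightarrow> (pi / 2) / u) at_top"
    using assms by (intro tendsto_intros filterlim_compose[OF tendsto_arctan_at_top]) auto
  then have l1: "(((\<lambda>w. arctan ((w - v) / u) / u) \<circ> real_of_ereal) \<longlongrightarrow> (pi / 2) / u) (at_left \<infinity>)"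
    unfolding ereal_tendsto_simps .
  have "filterlim (\<lambda>w. (w - v) / u) at_bot at_bot" 
    using assms by real_asymp
  then have "((\<lambda>w. arctan ((w - v) / u) / u) \<longlongrightarrow> (- (pi / 2)) / u) at_bot"
    using assms by (intro tendsto_intros filterlim_compose[OF tendsto_arctan_at_bot]) auto
  then have l0: "(((\<lambda>w. arctan ((w - v) / u) / u) \<circ> real_of_ereal) \<longlongrightarrow> (- (pi / 2)) / u) (at_right (-\<infinity>))"
    unfolding ereal_tendsto_simps .
  have *: "set_integrable lborel (einterval (-\<infinity>) \<infinity>) (\<lambda>w. 1 / (u\<^sup>2 + (v - w)\<^sup>2))"
     "(LBINT w=-\<infinity>..\<infinity>. 1 / (u\<^sup>2 + (v - w)\<^sup>2)) = (pi / 2) / u - (- (pi / 2)) / u"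
    by (rule interval_integral_FTC_nonneg[OF _ D cont _ l0 l1]; simp add: less_imp_le[OF pos])+
  have "(\<lambda>w. 1 / (u\<^sup>2 + (v - w)\<^sup>2)) \<in> borel_measurable lborel" by simp
  then show ?A ?B using *
    by (simp_all add: integrable_completion integral_completion set_integrable_def interval_lebesgue_integral_def set_lebesgue_integral_def field_simps)
qed

section \<open>Complex scalars acting on the Clifford algebra\<close>

lemma bounded_bilinear_cl_mult: "bounded_bilinear ((\<odot>) :: 'n::{finite,linorder} cliff \<Rightarrow> _)"
  using bilinear_cl_mult by (simp add: bilinear_conv_bounded_bilinear)

interpretation cl_mult: bounded_bilinear "(\<odot>) :: 'n::{finite,linorder} cliff \<Rightarrow> _"
  by (rule bounded_bilinear_cl_mult)

lemma bounded_linear_cl_complex: "bounded_linear (cl_complex I)"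
  unfolding cl_complex_def
  by (intro bounded_linear_add bounded_linear_scaleR_const bounded_linear_Re bounded_linear_Im)

definition cl_act :: "real ^ 'n::{finite,linorder} \<Rightarrow> complex \<Rightarrow> 'n cliff \<Rightarrow> 'n cliff" where
  "cl_act I z x = cl_complex I z \<odot> x"

interpretation cl_act: bounded_bilinear "cl_act I" for I :: "real ^ 'n::{finite,linorder}"
proof -
  have "bounded_bilinear (\<lambda>z x. cl_complex I z \<odot> x)"
    by (rule bounded_bilinear.comp1[OF bounded_bilinear_cl_mult bounded_linear_cl_complex])
  then show "bounded_bilinear (cl_act I)" by (simp add: cl_act_def[abs_def])
qed

lemma cl_complex_mult:
  assumes I: "I \<in> imag_units"
  shows "cl_complex I (z * w) = cl_complex I z \<odot> cl_complex I w"
  by (simp add: cl_complex_def cl_mult.add_left cl_mult.add_right cl_mult.scaleR_left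
      cl_mult.scaleR_right cl_vec_square[OF I] cl_mult_one algebra_simps)

lemma cl_act_mult: "I \<in> imag_units \<Longrightarrow> cl_act I (z * w) x = cl_act I z (cl_act I w x)"
  by (simp add: cl_act_def cl_complex_mult cl_mult_assoc)

lemma cl_act_of_real: "cl_act I (of_real r) x = r *\<^sub>R x"
  by (simp add: cl_act_def cl_complex_def cl_mult.scaleR_left cl_mult_one)

lemma cl_vec_cl_vec: "I \<in> imag_units \<Longrightarrow> cl_vec I \<odot> (cl_vec I \<odot> x) = - x"
  using cl_vec_square[of I] by (metis cl_mult_assoc cl_mult.minus_left cl_mult_one(1))

lemma norm_cl_act_le:
  fixes I :: "real ^ 'n::{finite,linorder}"
  obtains C where "C > 0" "\<And>z x. norm (cl_act I z x) \<le> C * (norm z * norm x)"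
  using cl_act.pos_bounded[of I] by (metis mult.commute)

section \<open>Pairing with bounded square integrable kernels\<close>

text \<open>
  A substitute for Hoelder's inequality. It makes \<open>k y\<close> integrable for bounded square
  integrable \<open>k\<close> and \<open>p\<close>-integrable \<open>y\<close>, simultaneously for all exponents between 1 and 2. Replacing
  \<open>k\<close> and \<open>y\<close> by \<open>\<eta> k\<close> and \<open>y / \<eta>\<close> makes the contribution of \<open>k\<^sup>2\<close> arbitrarily small, which is
  what limits require.
\<close>

lemma kernel_young:
  fixes k y :: real
  assumes "1 \<le> p" "p \<le> 2" "0 \<le> k" "k \<le> M" "0 \<le> y"
  shows "k * y \<le> (M + 1) * y powr p + k\<^sup>2"
proof (cases "y \<ge> 1")
  case True
  then have "y \<le> y powr p" using assms powr_mono[of 1 p y] by simp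
  then have "k * y \<le> (M + 1) * y powr p" using assms by (intro mult_mono) auto
  moreover have "0 \<le> k\<^sup>2" by simp
  ultimately show ?thesis by linarith
next
  case False
  have "k * y \<le> k\<^sup>2 + y\<^sup>2"
    using sum_squares_bound[of k y] mult_nonneg_nonneg[OF assms(3,5)] by linarith
  also have "y\<^sup>2 = y powr 2" using assms by simp
  also have "y powr 2 \<le> y powr p"
  proof (cases "y = 0")
    case False
    then show ?thesis using powr_mono'[of p 2 y] assms \<open>\<not> y \<ge> 1\<close> by simp
  qed simp
  also have "\<dots> \<le> (M + 1) * y powr p" using assms by (simp add: algebra_simps)
  finally show ?thesis by simp
qed

lemma Lp_kernel_integrable:
  fixes g :: "real \<Rightarrow> 'n::{finite,linorder} cliff"
  assumes p: "1 \<le> p" "p \<le> 2" and g: "g \<in> Lp p"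
    and k: "k \<in> borel_measurable lebesgue" "\<And>w. norm (k w) \<le> M"
       "integrable lebesgue (\<lambda>w. (norm (k w))\<^sup>2)"
  shows "integrable lebesgue (\<lambda>w. norm (k w) * norm (g w))"
    and "integrable lebesgue (\<lambda>w. cl_act I (k w) (g w))"
proof -
  have g': "g \<in> borel_measurable lebesgue" "integrable lebesgue (\<lambda>w. norm (g w) powr p)"
    using g by (auto simp: Lp_def)
  have i: "integrable lebesgue (\<lambda>w. (M + 1) * norm (g w) powr p + (norm (k w))\<^sup>2)"
    using g' k by (intro Bochner_Integration.integrable_add integrable_mult_right)
  have "0 \<le> M" using k(2)[of 0] norm_ge_zero order_trans by blast
  then have "norm (norm (k w) * norm (g w)) \<le> norm ((M + 1) * norm (g w) powr p + (norm (k w))\<^sup>2)" for w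
    using kernel_young[OF p norm_ge_zero k(2)[of w] norm_ge_zero[of "g w"]] by simp
  then show *: "integrable lebesgue (\<lambda>w. norm (k w) * norm (g w))"
    using g' k by (intro Bochner_Integration.integrable_bound[OF i] AE_I2) auto
  obtain C where C: "C > 0" "\<And>z x. norm (cl_act I z x) \<le> C * (norm z * norm x)"
    using norm_cl_act_le[of I] by blast
  have m: "(\<lambda>w. cl_act I (k w) (g w)) \<in> borel_measurable lebesgue"
    using k(1) g'(1)
    by (rule borel_measurable_continuous_Pair) (intro continuous_intros cl_act.continuous_on)
  have "norm (cl_act I (k w) (g w)) \<le> norm (C * (norm (k w) * norm (g w)))" for w
    using C by simp
  then show "integrable lebesgue (\<lambda>w. cl_act I (k w) (g w))"
    by (intro Bochner_Integration.integrable_bound[OF integrable_mult_right[OF *, of C] m] AE_I2)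
qed

lemma ennreal_tendsto_0_scaled:
  fixes X Y :: "nat \<Rightarrow> ennreal"
  assumes Y: "Y \<longlonglongrightarrow> 0"
    and X: "\<And>\<epsilon>. \<epsilon> > 0 \<Longrightarrow> \<exists>C. \<forall>n. X n \<le> ennreal C * Y n + ennreal \<epsilon>"
  shows "X \<longlonglongrightarrow> 0"
proof (rule order_tendstoI)
  fix a :: ennreal assume "a > 0"
  then obtain b where b: "0 < b" "b < a" using dense by blast
  have "b < top" using b(2) top_greatest by (rule less_le_trans)
  then obtain \<epsilon> where e: "b = ennreal \<epsilon>" "\<epsilon> > 0" using b(1) by (cases b) (auto simp: ennreal_less_zero_iff)
  obtain C where C: "\<forall>n. X n \<le> ennreal C * Y n + ennreal \<epsilon>" using X[OF e(2)] by blast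
  have "(\<lambda>n. ennreal C * Y n + ennreal \<epsilon>) \<longlonglongrightarrow> ennreal C * 0 + ennreal \<epsilon>"
    by (intro tendsto_add ennreal_tendsto_cmult Y tendsto_const) auto
  then have "\<forall>\<^sub>F n in sequentially. ennreal C * Y n + ennreal \<epsilon> < a"
    using b e by (intro order_tendstoD) auto
  then show "\<forall>\<^sub>F n in sequentially. X n < a"
    by eventually_elim (use C le_less_trans in blast)
qed auto

lemma tendsto_0_of_ennreal_norm:
  assumes "((\<lambda>n. ennreal (norm (x n))) \<longlongrightarrow> 0) F"
  shows "(x \<longlongrightarrow> 0) F"
proof -
  have "((\<lambda>n. norm (x n)) \<longlongrightarrow> 0) F"
    using assms tendsto_ennreal_iff[of "\<lambda>n. norm (x n)" F 0] by simp
  then show ?thesis by (simp add: tendsto_norm_zero_iff)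
qed

text \<open>
  Integrating against the kernel is continuous on \<open>L\<^sup>p\<close>: the rescaled form of \<open>kernel_young\<close> bounds
  the error by a multiple of the \<open>p\<close>-th power integral of \<open>a n - g\<close> plus an arbitrarily small constant.
\<close>

lemma Lp_converges_pairing:
  fixes a :: "nat \<Rightarrow> real \<Rightarrow> 'n::{finite,linorder} cliff"
  assumes p: "1 \<le> p" "p \<le> 2" and a: "\<And>n. a n \<in> Lp p" and g: "g \<in> Lp p"
    and conv: "Lp_converges p a g"
    and k: "k \<in> borel_measurable lebesgue" "\<And>w. norm (k w) \<le> M"
       "integrable lebesgue (\<lambda>w. (norm (k w))\<^sup>2)"
  shows "(\<lambda>n. LINT w|lebesgue. cl_act I (k w) (a n w)) \<longlonglongrightarrow> (LINT w|lebesgue. cl_act I (k w) (g w))"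
proof -
  obtain C where C: "C > 0" "\<And>z x. norm (cl_act I z x) \<le> C * (norm z * norm x)"
    using norm_cl_act_le[of I] by blast
  have meas: "a n \<in> borel_measurable lebesgue" "g \<in> borel_measurable lebesgue" for n
    using a g by (auto simp: Lp_def)
  have M: "0 \<le> M" using k(2)[of 0] norm_ge_zero order_trans by blast
  define s where "s = (LINT w|lebesgue. (norm (k w))\<^sup>2)"
  have s: "s \<ge> 0" unfolding s_def by simp
  have nns: "(\<integral>\<^sup>+w. ennreal ((norm (k w))\<^sup>2) \<partial>lebesgue) = ennreal s"
    unfolding s_def by (rule nn_integral_eq_integral[OF k(3)]) simp
  define X where "X n = (\<integral>\<^sup>+w. ennreal (C * (norm (k w) * norm (a n w - g w))) \<partial>lebesgue)" for n
  have X0: "X \<longlonglongrightarrow> 0"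
  proof (rule ennreal_tendsto_0_scaled[OF conv[unfolded Lp_converges_def]])
    fix \<epsilon> :: real assume \<epsilon>: "\<epsilon> > 0"
    \<comment> \<open>Chosen so that the contribution of the squared kernel, \<open>C \<eta>\<^sup>2 s\<close>, is at most \<open>\<epsilon>\<close>.\<close>
    define \<eta> where "\<eta> = sqrt (\<epsilon> / (C * (s + 1)))"
    have \<eta>: "\<eta> > 0" using \<epsilon> s C by (simp add: \<eta>_def)
    have \<eta>2: "C * \<eta>\<^sup>2 * s \<le> \<epsilon>"
    proof -
      have "C * \<eta>\<^sup>2 * s = \<epsilon> * (s / (s + 1))"
      proof -
        have "\<eta>\<^sup>2 = \<epsilon> / (s + 1) / C" using \<epsilon> s C by (simp add: \<eta>_def)
        then show ?thesis using C by simp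
      qed
      also have "\<dots> \<le> \<epsilon> * 1" using \<epsilon> s by (intro mult_left_mono) auto
      finally show ?thesis by simp
    qed
    define K where "K = C * ((\<eta> * M + 1) * \<eta> powr (- p))"
    have K: "K \<ge> 0" unfolding K_def using C \<eta> M by simp
    have "X n \<le> ennreal K * (\<integral>\<^sup>+w. ennreal (norm (a n w - g w) powr p) \<partial>lebesgue) + ennreal \<epsilon>" for n
    proof -
      have "C * (norm (k w) * norm (a n w - g w)) \<le> K * norm (a n w - g w) powr p + C * \<eta>\<^sup>2 * (norm (k w))\<^sup>2" for w
      proof -
        let ?d = "norm (a n w - g w)"
        have "norm (k w) * ?d = (\<eta> * norm (k w)) * (?d / \<eta>)" using \<eta> by simp
        also have "\<dots> \<le> (\<eta> * M + 1) * (?d / \<eta>) powr p + (\<eta> * norm (k w))\<^sup>2"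
          using \<eta> k(2)[of w] by (intro kernel_young[OF p]) (auto intro: mult_left_mono)
        also have "(?d / \<eta>) powr p = \<eta> powr (- p) * ?d powr p"
          using \<eta> by (simp add: powr_divide powr_minus field_simps)
        finally have "C * (norm (k w) * ?d) \<le> C * ((\<eta> * M + 1) * (\<eta> powr (- p) * ?d powr p) + (\<eta> * norm (k w))\<^sup>2)"
          using C by (intro mult_left_mono) auto
        then show ?thesis by (simp add: K_def algebra_simps power_mult_distrib)
      qed
      then have "X n \<le> (\<integral>\<^sup>+w. ennreal K * ennreal (norm (a n w - g w) powr p) + ennreal (C * \<eta>\<^sup>2) * ennreal ((norm (k w))\<^sup>2) \<partial>lebesgue)"
        unfolding X_def using K C
        by (intro nn_integral_mono) (simp add: ennreal_mult[symmetric] ennreal_plus[symmetric] ennreal_leI del: ennreal_plus)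
      also have "\<dots> = ennreal K * (\<integral>\<^sup>+w. ennreal (norm (a n w - g w) powr p) \<partial>lebesgue) + ennreal (C * \<eta>\<^sup>2) * ennreal s"
        unfolding nns[symmetric] using k(1) meas
        by (subst nn_integral_add) (auto simp: nn_integral_cmult)
      also have "ennreal (C * \<eta>\<^sup>2) * ennreal s \<le> ennreal \<epsilon>"
        using C s \<eta>2 by (simp add: ennreal_mult[symmetric] ennreal_leI)
      finally show ?thesis by (simp add: add_left_mono)
    qed
    then show "\<exists>C. \<forall>n. X n \<le> ennreal C * (\<integral>\<^sup>+w. ennreal (norm (a n w - g w) powr p) \<partial>lebesgue) + ennreal \<epsilon>" by blast
  qed
  have dist: "ennreal (norm ((LINT w|lebesgue. cl_act I (k w) (a n w)) - (LINT w|lebesgue. cl_act I (k w) (g w)))) \<le> X n" for n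
  proof -
    have i: "integrable lebesgue (\<lambda>w. cl_act I (k w) (a n w))" "integrable lebesgue (\<lambda>w. cl_act I (k w) (g w))"
      using Lp_kernel_integrable(2)[OF p _ k] a g by auto
    have "norm ((LINT w|lebesgue. cl_act I (k w) (a n w)) - (LINT w|lebesgue. cl_act I (k w) (g w)))
        \<le> (\<integral>\<^sup>+w. norm (cl_act I (k w) (a n w) - cl_act I (k w) (g w)) \<partial>lebesgue)"
      using integral_norm_bound_ennreal[OF Bochner_Integration.integrable_diff[OF i]] i by simp
    also have "\<dots> \<le> X n"
      unfolding X_def using C(2) by (intro nn_integral_mono ennreal_leI) (simp flip: cl_act.diff_right)
    finally show ?thesis .
  qed
  have "(\<lambda>n. ennreal (norm ((LINT w|lebesgue. cl_act I (k w) (a n w)) - (LINT w|lebesgue. cl_act I (k w) (g w))))) \<longlonglongrightarrow> 0"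
    by (rule tendsto_sandwich[OF _ _ tendsto_const X0]) (use dist in auto)
  then have "(\<lambda>n. (LINT w|lebesgue. cl_act I (k w) (a n w)) - (LINT w|lebesgue. cl_act I (k w) (g w))) \<longlonglongrightarrow> 0"
    by (rule tendsto_0_of_ennreal_norm)
  then show ?thesis by (rule LIM_zero_cancel)
qed

section \<open>The spectral condition and the conjugate Cauchy integral\<close>

text \<open>
  Fubini's theorem, after writing \<open>1 / (c + i w)\<close> as the integral of \<open>exp (- c x) exp (- i w x)\<close>
  over \<open>x > 0\<close>. The argument runs on a Borel representative of \<open>a\<close>, so that the integrand is measurable
  for the product of two Lebesgue-Borel measures.
\<close>

lemma Laplace_of_fourier_L1:
  fixes a :: "real \<Rightarrow> 'n::{finite,linorder} cliff"
  assumes I: "I \<in> imag_units" and a: "integrable lebesgue a" and c: "Re c > 0"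
  shows "cl_fourier_L1 I a \<in> borel_measurable borel"
    and "(LINT w|lebesgue. cl_act I (1 / (c + \<i> * of_real w)) (a w)) =
      sqrt (2 * pi) *\<^sub>R (LINT x|lborel. cl_act I (indicator {0<..} x *\<^sub>R exp (- (c * of_real x))) (cl_fourier_L1 I a x))"
proof -
  have am: "a \<in> borel_measurable lebesgue" using a by auto
  obtain b where b [measurable]: "b \<in> borel_measurable borel" and ab: "AE x in lborel. a x = b x"
    using lebesgue_measurable_ae_borel[OF am] .
  have abc: "AE x in lebesgue. a x = b x" using ab by (simp add: AE_completion_iff)
  have bm: "b \<in> borel_measurable lebesgue" by (rule measurable_completion) simp
  have bi: "integrable lborel b"
    using a abc am bm b integrable_cong_AE[of a lebesgue b] by (simp add: integrable_completion)
  have actm [measurable (raw)]: "(\<lambda>x. cl_act I (f x) (h x)) \<in> borel_measurable M"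
    if "f \<in> borel_measurable M" "h \<in> borel_measurable M" for f and h :: "'z \<Rightarrow> 'n cliff" and M
    using that by (rule borel_measurable_continuous_Pair) (intro continuous_intros cl_act.continuous_on)
  have replace: "(LINT w|lebesgue. cl_act I (k w) (a w)) = (LINT w|lborel. cl_act I (k w) (b w))"
    if [measurable]: "k \<in> borel_measurable borel" for k
  proof -
    have km: "k \<in> borel_measurable lebesgue" by (rule measurable_completion) simp
    have "(LINT w|lebesgue. cl_act I (k w) (a w)) = (LINT w|lebesgue. cl_act I (k w) (b w))"
      by (rule integral_cong_AE) (use abc km am bm in \<open>auto intro!: actm elim!: eventually_mono\<close>)
    also have "\<dots> = (LINT w|lborel. cl_act I (k w) (b w))"
      by (rule integral_completion) simp
    finally show ?thesis .
  qed
  have F: "cl_fourier_L1 I a x = (1 / sqrt (2 * pi)) *\<^sub>R (LINT w|lborel. cl_act I (exp (- (\<i> * of_real (w * x)))) (b w))" for x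
    unfolding cl_fourier_L1_def cl_act_def[symmetric] by (subst replace) auto
  show "cl_fourier_L1 I a \<in> borel_measurable borel"
    unfolding F[abs_def] by measurable
  define E where "E x = indicator {0<..} x *\<^sub>R exp (- (c * complex_of_real x))" for x :: real
  have E [measurable]: "E \<in> borel_measurable borel" unfolding E_def by measurable
  define f where "f w x = cl_act I (E x * exp (- (\<i> * of_real (w * x)))) (b w)" for w x :: real
  have fm [measurable]: "(\<lambda>(w, x). f w x) \<in> borel_measurable (lborel \<Otimes>\<^sub>M lborel)"
    unfolding f_def case_prod_beta by measurable
  obtain C where C: "C > 0" "\<And>z x. norm (cl_act I z x) \<le> C * (norm z * norm x)"
    using norm_cl_act_le[of I] by blast
  let ?e = "\<lambda>x::real. indicator {0<..} x * exp (- (Re c * x)) :: real"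
  have nE: "norm (E x) = ?e x" for x by (simp add: E_def indicator_def)
  have "integrable (lborel \<Otimes>\<^sub>M lborel) (\<lambda>(w, x). (C * norm (b w)) * ?e x)"
  proof (rule lborel_pair.Fubini_integrable)
    show "(\<lambda>(w, x). (C * norm (b w)) * ?e x) \<in> borel_measurable (lborel \<Otimes>\<^sub>M lborel)"
      by measurable
    have "(LINT x|lborel. norm (case (w, x) of (w, x) \<Rightarrow> (C * norm (b w)) * ?e x)) = C * norm (b w) * (1 / Re c)" for w
      using exp_decay_integral_real(2)[OF c] C(1) by (simp add: abs_mult)
    then show "integrable lborel (\<lambda>w. LINT x|lborel. norm (case (w, x) of (w, x) \<Rightarrow> (C * norm (b w)) * ?e x))"
      using bi by simp
    show "AE w in lborel. integrable lborel (\<lambda>x. case (w, x) of (w, x) \<Rightarrow> (C * norm (b w)) * ?e x)"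
      using exp_decay_integral_real(1)[OF c] by (intro AE_I2) simp
  qed
  then have fi: "integrable (lborel \<Otimes>\<^sub>M lborel) (\<lambda>(w, x). f w x)"
  proof (rule Bochner_Integration.integrable_bound[OF _ fm], intro AE_I2)
    fix y :: "real \<times> real"
    obtain w x where y: "y = (w, x)" by (cases y)
    have "norm (f w x) \<le> C * (norm (E x * exp (- (\<i> * of_real (w * x)))) * norm (b w))"
      unfolding f_def by (rule C)
    then show "norm (case y of (w, x) \<Rightarrow> f w x) \<le> norm (case y of (w, x) \<Rightarrow> (C * norm (b w)) * ?e x)"
      using C(1) by (simp add: y norm_mult nE abs_mult mult_ac)
  qed
  have inner1: "(LINT x|lborel. f w x) = cl_act I (1 / (c + \<i> * of_real w)) (b w)" for w
  proof -
    have c': "Re (c + \<i> * of_real w) > 0" using c by simp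
    have "f w x = cl_act I (indicator {0<..} x *\<^sub>R exp (- ((c + \<i> * of_real w) * of_real x))) (b w)" for x
      unfolding f_def E_def by (simp add: exp_add[symmetric] algebra_simps)
    then have "(LINT x|lborel. f w x) = (LINT x|lborel. cl_act I (indicator {0<..} x *\<^sub>R exp (- ((c + \<i> * of_real w) * of_real x))) (b w))"
      by (simp only:)
    also have "\<dots> = cl_act I (1 / (c + \<i> * of_real w)) (b w)"
      unfolding exp_decay_integral(2)[OF c', symmetric]
      by (rule integral_bounded_linear[OF cl_act.bounded_linear_left exp_decay_integral(1)[OF c']])
    finally show ?thesis .
  qed
  have inner2: "(LINT w|lborel. f w x) = cl_act I (E x) (sqrt (2 * pi) *\<^sub>R cl_fourier_L1 I a x)" for x
  proof -
    have "integrable lborel (\<lambda>w. cl_act I (exp (- (\<i> * of_real (w * x)))) (b w))"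
      by (rule Bochner_Integration.integrable_bound[OF integrable_mult_right[OF integrable_norm[OF bi], of C]])
        (use C(2)[of "exp (- (\<i> * of_real (_ * x)))"] C(1) in \<open>auto simp: abs_mult\<close>)
    then show ?thesis
      unfolding f_def cl_act_mult[OF I] F
      using integral_bounded_linear[OF cl_act.bounded_linear_right] by simp
  qed
  have "(LINT w|lebesgue. cl_act I (1 / (c + \<i> * of_real w)) (a w)) = (LINT w|lborel. LINT x|lborel. f w x)"
    unfolding inner1 by (rule replace) measurable
  also have "\<dots> = (LINT x|lborel. LINT w|lborel. f w x)"
    using lborel_pair.Fubini_integral[OF fi] by simp
  also have "\<dots> = sqrt (2 * pi) *\<^sub>R (LINT x|lborel. cl_act I (E x) (cl_fourier_L1 I a x))"
    unfolding inner2 cl_act.scaleR_right by simp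
  finally show "(LINT w|lebesgue. cl_act I (1 / (c + \<i> * of_real w)) (a w)) =
      sqrt (2 * pi) *\<^sub>R (LINT x|lborel. cl_act I (indicator {0<..} x *\<^sub>R exp (- (c * of_real x))) (cl_fourier_L1 I a x))"
    by (simp add: E_def)
qed
text \<open>
  The union in the definition of the essential support may be uncountable; Lindelof's theorem
  reduces it to countably many open sets.
\<close>

lemma AE_zero_off_ess_support: "AE w in lebesgue. w \<notin> ess_support h \<longrightarrow> h w = 0"
proof -
  define \<U> where "\<U> = {U. open U \<and> (AE w in lebesgue. w \<in> U \<longrightarrow> h w = 0)}"
  obtain \<V> where \<V>: "\<V> \<subseteq> \<U>" "countable \<V>" "\<Union>\<V> = \<Union>\<U>"
    using Lindelof[of \<U>] by (auto simp: \<U>_def)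
  have "AE w in lebesgue. \<forall>V\<in>\<V>. w \<in> V \<longrightarrow> h w = 0"
    unfolding AE_ball_countable[OF \<V>(2)] using \<V>(1) by (auto simp: \<U>_def)
  then show ?thesis
    by eventually_elim (use \<V>(3) in \<open>auto simp: ess_support_def \<U>_def[symmetric]\<close>)
qed

lemma cauchy_kernel:
  assumes "Re z > 0"
  shows "(\<lambda>w. 1 / (z - \<i> * of_real w)) \<in> borel_measurable lebesgue"
    and "norm (1 / (z - \<i> * of_real w)) \<le> 1 / Re z"
    and "integrable lebesgue (\<lambda>w. (norm (1 / (z - \<i> * of_real w)))\<^sup>2)"
proof -
  show "(\<lambda>w. 1 / (z - \<i> * of_real w)) \<in> borel_measurable lebesgue"
    by (rule measurable_completion) simp
  have "Re z \<le> norm (z - \<i> * of_real w)"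
    using complex_Re_le_cmod[of "z - \<i> * of_real w"] by simp
  then show "norm (1 / (z - \<i> * of_real w)) \<le> 1 / Re z"
    using assms by (simp add: norm_divide frac_le)
  have "(norm (1 / (z - \<i> * of_real w)))\<^sup>2 = 1 / ((Re z)\<^sup>2 + (Im z - w)\<^sup>2)" for w
    by (simp add: norm_divide power_divide cmod_power2)
  then show "integrable lebesgue (\<lambda>w. (norm (1 / (z - \<i> * of_real w)))\<^sup>2)"
    using inverse_quadratic_integral(1)[OF assms] by simp
qed

lemma cnj_cauchy_kernel: "1 / (cnj z + \<i> * of_real w) = cnj (1 / (z - \<i> * of_real w))"
  by simp

lemma cnj_cauchy_kernel_bounds:
  assumes "Re z > 0"
  shows "(\<lambda>w. 1 / (cnj z + \<i> * of_real w)) \<in> borel_measurable lebesgue"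
    and "norm (1 / (cnj z + \<i> * of_real w)) \<le> 1 / Re z"
    and "integrable lebesgue (\<lambda>w. (norm (1 / (cnj z + \<i> * of_real w)))\<^sup>2)"
proof -
  show "(\<lambda>w. 1 / (cnj z + \<i> * of_real w)) \<in> borel_measurable lebesgue"
    by (rule measurable_completion) simp
  show "norm (1 / (cnj z + \<i> * of_real w)) \<le> 1 / Re z"
    "integrable lebesgue (\<lambda>w. (norm (1 / (cnj z + \<i> * of_real w)))\<^sup>2)"
    unfolding cnj_cauchy_kernel complex_mod_cnj using cauchy_kernel[OF assms] by auto
qed

text \<open>
  The only place where the condition on the spectrum is used. For \<open>p = 1\<close> the Laplace formula
  integrates the zero function. For \<open>p > 1\<close> the formula holds for the approximating sequence, and on
  the right half line its Fourier transforms tend to 0 in \<open>L\<^sup>q\<close> because the limit \<open>h\<close> vanishes there.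
\<close>

lemma conjugate_cauchy_integral_eq_0:
  fixes g :: "real \<Rightarrow> 'n::{finite,linorder} cliff"
  assumes p: "1 \<le> p" "p \<le> 2" and I: "I \<in> imag_units" and g: "g \<in> Lp p"
    and h: "has_cl_fourier p I g h" and supp: "ess_support h \<subseteq> {..0}" and z: "Re z > 0"
  shows "(LINT w|lebesgue. cl_act I (1 / (cnj z + \<i> * of_real w)) (g w)) = 0"
proof -
  have c: "Re (cnj z) > 0" using z by simp
  have h0: "AE x in lborel. x > 0 \<longrightarrow> h x = 0"
  proof -
    have "AE x in lborel. x \<notin> ess_support h \<longrightarrow> h x = 0"
      using AE_zero_off_ess_support[of h] by (simp only: AE_completion_iff)
    then show ?thesis by eventually_elim (use supp in auto)
  qed
  let ?S = "\<lambda>a. LINT w|lebesgue. cl_act I (1 / (cnj z + \<i> * of_real w)) (a w)"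
  let ?E = "\<lambda>x::real. indicator {0<..} x *\<^sub>R exp (- (cnj z * of_real x))"
  have L1: "integrable lebesgue a" if "a \<in> Lp 1" for a :: "real \<Rightarrow> 'n cliff"
    using that by (auto simp: Lp_def powr_one_gt_zero_iff intro: integrable_norm_cancel)
  show ?thesis
  proof (cases "p = 1")
    case True
    have "AE x in lborel. cl_act I (?E x) (h x) = 0"
      using h0 by eventually_elim (auto simp: indicator_def cl_act.zero_left cl_act.zero_right)
    then have "(LINT x|lborel. cl_act I (?E x) (h x)) = 0"
      by (rule integral_eq_zero_AE)
    then show ?thesis
      using Laplace_of_fourier_L1(2)[OF I L1 c, of g] g h True by (simp add: has_cl_fourier_def)
  next
    case False
    define q where "q = p / (p - 1)"
    have q: "q \<ge> 1" using p False by (simp add: q_def field_simps)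
    obtain a where a: "\<And>n. a n \<in> Lp 1" "\<And>n. a n \<in> Lp p" "Lp_converges p a g"
        and ah: "Lp_converges q (\<lambda>n. cl_fourier_L1 I (a n)) h" and hq: "h \<in> Lp q"
      using h False unfolding has_cl_fourier_def q_def by auto
    have lim: "(\<lambda>n. ?S (a n)) \<longlonglongrightarrow> ?S g"
      by (rule Lp_converges_pairing[OF p a(2) g a(3) cnj_cauchy_kernel_bounds[OF z]])
    obtain C where C: "C > 0" "\<And>z x. norm (cl_act I z x) \<le> C * (norm z * norm x)"
      using norm_cl_act_le[of I] by blast
    let ?e = "\<lambda>x::real. indicator {0<..} x * exp (- (Re z * x)) :: real"
    have nE: "norm (?E x) = ?e x" for x by (simp add: indicator_def)
    define s where "s = 1 / Re z"
    have s: "s > 0" using z by (simp add: s_def)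
    have nns: "(\<integral>\<^sup>+x. ennreal (?e x) \<partial>lebesgue) = ennreal s"
      unfolding s_def nn_integral_completion using exp_decay_integral_real[OF z]
      by (subst nn_integral_eq_integral) auto
    define B where "B = sqrt (2 * pi) * C"
    have B: "B > 0" using C by (simp add: B_def)
    define X where "X n = (\<integral>\<^sup>+x. ennreal (B * (?e x * norm (cl_fourier_L1 I (a n) x - h x))) \<partial>lebesgue)" for n
    have X0: "X \<longlonglongrightarrow> 0"
    proof (rule ennreal_tendsto_0_scaled[OF ah[unfolded Lp_converges_def]])
      fix \<epsilon> :: real assume \<epsilon>: "\<epsilon> > 0"
      \<comment> \<open>Where the transforms differ by at most \<open>\<eta>\<close> the cost is \<open>B \<eta> s = \<epsilon>\<close>; elsewhere the difference divided by \<open>\<eta>\<close> is at most its \<open>q\<close>-th power.\<close>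
      define \<eta> where "\<eta> = \<epsilon> / (B * s)"
      have \<eta>: "\<eta> > 0" using \<epsilon> B s by (simp add: \<eta>_def)
      define K where "K = B * (\<eta> * \<eta> powr (- q))"
      have K: "K \<ge> 0" unfolding K_def using B \<eta> by simp
      have "X n \<le> ennreal K * (\<integral>\<^sup>+x. ennreal (norm (cl_fourier_L1 I (a n) x - h x) powr q) \<partial>lebesgue) + ennreal \<epsilon>" for n
      proof -
        have "B * (?e x * norm (cl_fourier_L1 I (a n) x - h x))
            \<le> K * norm (cl_fourier_L1 I (a n) x - h x) powr q + (B * \<eta>) * ?e x" for x
        proof -
          let ?d = "norm (cl_fourier_L1 I (a n) x - h x)"
          have e: "0 \<le> ?e x" "?e x \<le> 1" using z by (auto simp: indicator_def)
          have dq: "?d / \<eta> \<le> 1 + (?d / \<eta>) powr q"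
          proof (cases "?d / \<eta> \<ge> 1")
            case True
            then have "(?d / \<eta>) powr 1 \<le> (?d / \<eta>) powr q" by (rule powr_mono[OF q])
            then show ?thesis using True \<eta> by simp
          next
            case False
            moreover have "0 \<le> (?d / \<eta>) powr q" by simp
            ultimately show ?thesis by linarith
          qed
          have "?e x * ?d = \<eta> * ?e x * (?d / \<eta>)" using \<eta> by simp
          also have "\<dots> \<le> \<eta> * ?e x * (1 + (?d / \<eta>) powr q)"
            using \<eta> e dq by (intro mult_left_mono) auto
          also have "\<dots> = \<eta> * ?e x + ?e x * (\<eta> * (?d / \<eta>) powr q)" by (simp add: algebra_simps)
          also have "\<dots> \<le> \<eta> * ?e x + 1 * (\<eta> * (?d / \<eta>) powr q)"
            using \<eta> e by (intro add_left_mono mult_right_mono) auto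
          also have "(?d / \<eta>) powr q = \<eta> powr (- q) * ?d powr q"
            using \<eta> by (simp add: powr_divide powr_minus field_simps)
          finally have "B * (?e x * ?d) \<le> B * (\<eta> * ?e x + 1 * (\<eta> * (\<eta> powr (- q) * ?d powr q)))"
            using B by (intro mult_left_mono) auto
          then show ?thesis by (simp add: K_def algebra_simps)
        qed
        then have "X n \<le> (\<integral>\<^sup>+x. ennreal K * ennreal (norm (cl_fourier_L1 I (a n) x - h x) powr q) + ennreal (B * \<eta>) * ennreal (?e x) \<partial>lebesgue)"
          unfolding X_def using K B \<eta>
          by (intro nn_integral_mono) (simp add: ennreal_mult[symmetric] ennreal_plus[symmetric] ennreal_leI del: ennreal_plus)
        also have "\<dots> = ennreal K * (\<integral>\<^sup>+x. ennreal (norm (cl_fourier_L1 I (a n) x - h x) powr q) \<partial>lebesgue) + ennreal (B * \<eta>) * ennreal s"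
        proof -
          have [measurable]: "h \<in> borel_measurable lebesgue" using hq by (simp add: Lp_def)
          have [measurable]: "cl_fourier_L1 I (a n) \<in> borel_measurable lebesgue"
            by (rule measurable_completion) (simp add: Laplace_of_fourier_L1(1)[OF I L1[OF a(1)] c])
          have [measurable]: "?e \<in> borel_measurable lebesgue" by (rule measurable_completion) simp
          have m1: "(\<lambda>x. ennreal (norm (cl_fourier_L1 I (a n) x - h x) powr q)) \<in> borel_measurable lebesgue"
            and m2: "(\<lambda>x. ennreal (?e x)) \<in> borel_measurable lebesgue"
            by measurable
          show ?thesis
            using nns by (simp only: nn_integral_add nn_integral_cmult m1 m2 borel_measurable_times_ennreal borel_measurable_const)
        qed
        also have "ennreal (B * \<eta>) * ennreal s = ennreal \<epsilon>"
          using B s \<epsilon> \<eta> by (subst ennreal_mult[symmetric]) (auto simp: \<eta>_def)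
        finally show ?thesis .
      qed
      then show "\<exists>C. \<forall>n. X n \<le> ennreal C * (\<integral>\<^sup>+x. ennreal (norm (cl_fourier_L1 I (a n) x - h x) powr q) \<partial>lebesgue) + ennreal \<epsilon>" by blast
    qed
    have SX: "ennreal (norm (?S (a n))) \<le> X n" for n
    proof -
      let ?L = "LINT x|lborel. cl_act I (?E x) (cl_fourier_L1 I (a n) x)"
      have "ennreal (norm ?L) \<le> (\<integral>\<^sup>+x. norm (cl_act I (?E x) (cl_fourier_L1 I (a n) x)) \<partial>lborel)"
      proof (cases "integrable lborel (\<lambda>x. cl_act I (?E x) (cl_fourier_L1 I (a n) x))")
        case True
        then show ?thesis by (rule integral_norm_bound_ennreal)
      qed (simp add: not_integrable_integral_eq)
      also have "\<dots> \<le> (\<integral>\<^sup>+x. ennreal (C * (?e x * norm (cl_fourier_L1 I (a n) x - h x))) \<partial>lborel)"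
      proof (rule nn_integral_mono_AE)
        show "AE x in lborel. ennreal (norm (cl_act I (?E x) (cl_fourier_L1 I (a n) x)))
            \<le> ennreal (C * (?e x * norm (cl_fourier_L1 I (a n) x - h x)))"
          using h0
        proof eventually_elim
          case (elim x)
          have "norm (cl_act I (?E x) (cl_fourier_L1 I (a n) x)) \<le> C * (?e x * norm (cl_fourier_L1 I (a n) x))"
            using C(2)[of "?E x"] unfolding nE .
          also have "\<dots> = C * (?e x * norm (cl_fourier_L1 I (a n) x - h x))"
            using elim by (simp add: indicator_def)
          finally show ?case by (rule ennreal_leI)
        qed
      qed
      finally have "ennreal (sqrt (2 * pi)) * ennreal (norm ?L) \<le>
          ennreal (sqrt (2 * pi)) * (\<integral>\<^sup>+x. ennreal (C * (?e x * norm (cl_fourier_L1 I (a n) x - h x))) \<partial>lebesgue)"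
        unfolding nn_integral_completion by (rule mult_left_mono) simp
      also have "\<dots> = X n"
      proof -
        have [measurable]: "h \<in> borel_measurable lebesgue" using hq by (simp add: Lp_def)
        have [measurable]: "cl_fourier_L1 I (a n) \<in> borel_measurable lebesgue"
          by (rule measurable_completion) (simp add: Laplace_of_fourier_L1(1)[OF I L1[OF a(1)] c])
        have [measurable]: "?e \<in> borel_measurable lebesgue" by (rule measurable_completion) simp
        have "(\<lambda>x. ennreal (C * (?e x * norm (cl_fourier_L1 I (a n) x - h x)))) \<in> borel_measurable lebesgue"
          by measurable
        from nn_integral_cmult[OF this, of "ennreal (sqrt (2 * pi))"] show ?thesis
          unfolding X_def B_def by (simp add: ennreal_mult'[symmetric] mult.assoc)
      qed
      finally show ?thesis
        using Laplace_of_fourier_L1(2)[OF I L1[OF a(1)] c, of n] by (simp add: ennreal_mult)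
    qed
    have "(\<lambda>n. ennreal (norm (?S (a n)))) \<longlonglongrightarrow> 0"
      by (rule tendsto_sandwich[OF _ _ tendsto_const X0]) (use SX in auto)
    then have "(\<lambda>n. ?S (a n)) \<longlonglongrightarrow> 0" by (rule tendsto_0_of_ennreal_norm)
    then show ?thesis using LIMSEQ_unique[OF lim] by simp
  qed
qed

section \<open>The Cauchy integral\<close>

text \<open>
  The Poisson kernel is \<open>1 / \<pi>\<close> times the real part of the Cauchy kernel.
\<close>

lemma poisson_integral_split:
  fixes g :: "real \<Rightarrow> 'n::{finite,linorder} cliff"
  assumes p: "1 \<le> p" "p \<le> 2" and g: "g \<in> Lp p" and u: "u > 0"
  shows "(LINT w|lebesgue. poisson_kernel u (v - w) *\<^sub>R g w) =
    (1 / (2 * pi)) *\<^sub>R ((LINT w|lebesgue. cl_act I (1 / (Complex u v - \<i> * of_real w)) (g w))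
      + (LINT w|lebesgue. cl_act I (1 / (cnj (Complex u v) + \<i> * of_real w)) (g w)))"
proof -
  let ?z = "Complex u v"
  have z: "Re ?z > 0" using u by simp
  note i = Lp_kernel_integrable(2)[OF p g cauchy_kernel[OF z], of I]
    Lp_kernel_integrable(2)[OF p g cnj_cauchy_kernel_bounds[OF z], of I]
  have "poisson_kernel u (v - w) *\<^sub>R g w = (1 / (2 * pi)) *\<^sub>R
      (cl_act I (1 / (?z - \<i> * of_real w)) (g w) + cl_act I (1 / (cnj ?z + \<i> * of_real w)) (g w))" for w
  proof -
    have "1 / (?z - \<i> * of_real w) + 1 / (cnj ?z + \<i> * of_real w) = of_real (2 * Re (1 / (?z - \<i> * of_real w)))"
      unfolding cnj_cauchy_kernel by (rule complex_add_cnj)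
    also have "2 * Re (1 / (?z - \<i> * of_real w)) = 2 * pi * poisson_kernel u (v - w)"
      using u by (simp add: poisson_kernel_eq Re_divide)
    finally show ?thesis
      by (simp add: cl_act.add_left[symmetric] cl_act_of_real del: of_real_mult)
  qed
  then show ?thesis
    using i by (simp add: Bochner_Integration.integral_add)
qed

text \<open>
  Differentiation under the integral sign, from the exact identity
  \<open>1 / (y - i w) - 1 / (z - i w) + (y - z) / (z - i w)\<^sup>2 = (y - z)\<^sup>2 / ((z - i w)\<^sup>2 (y - i w))\<close>.
  The derivative has the form \<open>h \<mapsto> h D\<close> with a complex scalar \<open>h\<close> acting from the left, which encodes
  holomorphy.
\<close>

lemma cauchy_integral_has_derivative:
  fixes g :: "real \<Rightarrow> 'n::{finite,linorder} cliff"
  assumes p: "1 \<le> p" "p \<le> 2" and I: "I \<in> imag_units" and g: "g \<in> Lp p" and z: "Re z > 0"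
  shows "\<exists>D. ((\<lambda>z. LINT w|lebesgue. cl_act I (1 / (z - \<i> * of_real w)) (g w)) has_derivative
    (\<lambda>h. cl_act I h D)) (at z)"
proof -
  let ?k = "\<lambda>z w. 1 / (z - \<i> * of_real w) :: complex"
  let ?F = "\<lambda>z. LINT w|lebesgue. cl_act I (?k z w) (g w)"
  obtain C where C: "C > 0" "\<And>z x. norm (cl_act I z x) \<le> C * (norm z * norm x)"
    using norm_cl_act_le[of I] by blast
  have i: "integrable lebesgue (\<lambda>w. cl_act I (?k y w) (g w))" if "Re y > 0" for y
    by (rule Lp_kernel_integrable(2)[OF p g cauchy_kernel[OF that]])
  have km: "(\<lambda>w. - (?k z w)\<^sup>2) \<in> borel_measurable lebesgue"
    by (rule measurable_completion) simp
  have kb: "norm (- (?k z w)\<^sup>2) \<le> (1 / Re z)\<^sup>2" for w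
    using power_mono[OF cauchy_kernel(2)[OF z, of w], of 2] by (simp add: norm_power)
  have ki: "integrable lebesgue (\<lambda>w. (norm (- (?k z w)\<^sup>2))\<^sup>2)"
  proof (rule Bochner_Integration.integrable_bound[OF integrable_mult_right[OF cauchy_kernel(3)[OF z], of "(1 / Re z)\<^sup>2"]])
    show "(\<lambda>w. (norm (- (?k z w)\<^sup>2))\<^sup>2) \<in> borel_measurable lebesgue"
      by (rule measurable_completion) simp
    have "(norm (- k\<^sup>2))\<^sup>2 \<le> m * (norm k)\<^sup>2" if "norm (- k\<^sup>2) \<le> m" for k :: complex and m
    proof -
      have "norm (- k\<^sup>2) = (norm k)\<^sup>2" by (simp add: norm_power)
      then have "(norm (- k\<^sup>2))\<^sup>2 = norm (- k\<^sup>2) * (norm k)\<^sup>2" by (simp only: power2_eq_square)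
      then show ?thesis using mult_right_mono[OF that, of "(norm k)\<^sup>2"] by simp
    qed
    from this[OF kb]
    have "(norm (- (?k z w)\<^sup>2))\<^sup>2 \<le> (1 / Re z)\<^sup>2 * (norm (?k z w))\<^sup>2" for w .
    then show "AE w in lebesgue. norm ((norm (- (?k z w)\<^sup>2))\<^sup>2) \<le> norm ((1 / Re z)\<^sup>2 * (norm (?k z w))\<^sup>2)"
      by (intro AE_I2) (simp add: abs_mult)
  qed
  note k2 = Lp_kernel_integrable[OF p g km kb ki]
  define D where "D = (LINT w|lebesgue. cl_act I (- (?k z w)\<^sup>2) (g w))"
  define B where "B = C * (2 / Re z) * (LINT w|lebesgue. norm (- (?k z w)\<^sup>2) * norm (g w))"
  have B: "B \<ge> 0" unfolding B_def using C z by (intro mult_nonneg_nonneg integral_nonneg) auto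
  have rem: "norm (?F y - ?F z - cl_act I (y - z) D) \<le> B * (norm (y - z))\<^sup>2"
    if y: "norm (y - z) < Re z / 2" for y
  proof -
    have Rey: "Re y > Re z / 2"
      using abs_Re_le_cmod[of "y - z"] y by (simp add: abs_le_iff) 
    then have Rey0: "Re y > 0" using z by linarith
    have iD: "integrable lebesgue (\<lambda>w. cl_act I (y - z) (cl_act I (- (?k z w)\<^sup>2) (g w)))"
      by (rule integrable_bounded_linear[OF cl_act.bounded_linear_right k2(2)])
    have "cl_act I (y - z) D = (LINT w|lebesgue. cl_act I (y - z) (cl_act I (- (?k z w)\<^sup>2) (g w)))"
      unfolding D_def by (rule integral_bounded_linear[OF cl_act.bounded_linear_right k2(2), symmetric])
    then have "?F y - ?F z - cl_act I (y - z) D = (LINT w|lebesgue. cl_act I (?k y w) (g w) - cl_act I (?k z w) (g w)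
         - cl_act I (y - z) (cl_act I (- (?k z w)\<^sup>2) (g w)))"
      using i[OF Rey0] i[OF z] iD by simp
    then have "norm (?F y - ?F z - cl_act I (y - z) D) \<le> (LINT w|lebesgue. norm (cl_act I (?k y w) (g w) - cl_act I (?k z w) (g w)
         - cl_act I (y - z) (cl_act I (- (?k z w)\<^sup>2) (g w))))"
      by (simp only: integral_norm_bound)
    also have "\<dots> \<le> (LINT w|lebesgue. C * (2 / Re z) * (norm (y - z))\<^sup>2 * (norm (- (?k z w)\<^sup>2) * norm (g w)))"
    proof (rule integral_mono)
      show "integrable lebesgue (\<lambda>w. norm (cl_act I (?k y w) (g w) - cl_act I (?k z w) (g w)
         - cl_act I (y - z) (cl_act I (- (?k z w)\<^sup>2) (g w))))"
        by (intro integrable_norm Bochner_Integration.integrable_diff i[OF Rey0] i[OF z] iD)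
      show "integrable lebesgue (\<lambda>w. C * (2 / Re z) * (norm (y - z))\<^sup>2 * (norm (- (?k z w)\<^sup>2) * norm (g w)))"
        using k2(1) by (rule integrable_mult_right)
      fix w
      have nz: "z - \<i> * of_real w \<noteq> 0" "y - \<i> * of_real w \<noteq> 0"
        using z Rey0 by (auto simp: complex_eq_iff)
      have "?k y w - ?k z w - (y - z) * (- (?k z w)\<^sup>2) = (y - z)\<^sup>2 * (?k z w)\<^sup>2 * ?k y w"
        using nz by (simp add: divide_simps power2_eq_square) (simp add: algebra_simps)
      then have eq: "cl_act I (?k y w) (g w) - cl_act I (?k z w) (g w) - cl_act I (y - z) (cl_act I (- (?k z w)\<^sup>2) (g w))
          = cl_act I ((y - z)\<^sup>2 * (?k z w)\<^sup>2 * ?k y w) (g w)"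
        unfolding cl_act_mult[OF I, symmetric] cl_act.diff_left[symmetric] by simp
      have "norm (cl_act I ((y - z)\<^sup>2 * (?k z w)\<^sup>2 * ?k y w) (g w))
          \<le> C * (norm ((y - z)\<^sup>2 * (?k z w)\<^sup>2 * ?k y w) * norm (g w))" by (rule C)
      also have "\<dots> = C * ((norm (y - z))\<^sup>2 * norm (- (?k z w)\<^sup>2) * norm (?k y w) * norm (g w))"
      proof -
        have "norm (a\<^sup>2 * k\<^sup>2 * m) = (norm a)\<^sup>2 * norm (- k\<^sup>2) * norm m" for a k m :: complex
          by (simp add: norm_mult norm_power)
        then show ?thesis by (simp only:)
      qed
      also have "\<dots> \<le> C * ((norm (y - z))\<^sup>2 * norm (- (?k z w)\<^sup>2) * (2 / Re z) * norm (g w))"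
      proof -
        have "norm (?k y w) \<le> 1 / Re y" by (rule cauchy_kernel(2)[OF Rey0])
        also have "\<dots> \<le> 1 / (Re z / 2)" using Rey z by (intro divide_left_mono) auto
        finally have "norm (?k y w) \<le> 2 / Re z" by simp
        then show ?thesis
          using C(1) by (intro mult_left_mono mult_right_mono) auto
      qed
      also have "\<dots> = C * (2 / Re z) * (norm (y - z))\<^sup>2 * (norm (- (?k z w)\<^sup>2) * norm (g w))"
        by (simp only: mult_ac)
      finally show "norm (cl_act I (?k y w) (g w) - cl_act I (?k z w) (g w) - cl_act I (y - z) (cl_act I (- (?k z w)\<^sup>2) (g w)))
        \<le> C * (2 / Re z) * (norm (y - z))\<^sup>2 * (norm (- (?k z w)\<^sup>2) * norm (g w))"
        unfolding eq .
    qed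
    also have "\<dots> = B * (norm (y - z))\<^sup>2" by (simp add: B_def)
    finally show ?thesis .
  qed
  have "(?F has_derivative (\<lambda>h. cl_act I h D)) (at z)"
    unfolding has_derivative_at_alt
  proof (intro conjI allI impI)
    show "bounded_linear (\<lambda>h. cl_act I h D)" by (rule cl_act.bounded_linear_left)
    fix e :: real assume e: "e > 0"
    \<comment> \<open>The first bound keeps \<open>y\<close> away from the boundary, the second turns the quadratic remainder into \<open>e \<bar>y - z\<bar>\<close>.\<close>
    let ?d = "min (Re z / 2) (e / (B + 1))"
    show "\<exists>d>0. \<forall>y. norm (y - z) < d \<longrightarrow> norm (?F y - ?F z - cl_act I (y - z) D) \<le> e * norm (y - z)"
    proof (intro exI conjI allI impI)
      show "?d > 0" using z e B by simp
      fix y assume y: "norm (y - z) < ?d"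
      have "B * norm (y - z) \<le> (B + 1) * (e / (B + 1))"
        using y B by (intro mult_mono) auto
      also have "\<dots> = e" using B by simp
      finally have "B * norm (y - z) * norm (y - z) \<le> e * norm (y - z)" by (rule mult_right_mono) simp
      then show "norm (?F y - ?F z - cl_act I (y - z) D) \<le> e * norm (y - z)"
        using rem[of y] y by (simp add: power2_eq_square mult.assoc)
    qed
  qed
  then show ?thesis by blast
qed

section \<open>Slice monogenic functions from stem functions\<close>

lemma imag_units_iff_norm: "J \<in> imag_units \<longleftrightarrow> norm J = 1"
  unfolding imag_units_def norm_vec_def L2_set_def by simp

lemma bounded_linear_cl_vec: "bounded_linear cl_vec"
  unfolding cl_vec_def
  by (intro bounded_linear_sum bounded_linear_scaleR_const bounded_linear_vec_nth)

text \<open>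
  The form of the two derivatives expresses the Cauchy-Riemann equations for the pair formed by
  the even and the odd part of \<open>\<Phi>\<close>: \<open>a\<close> and \<open>b\<close> are the partial derivatives in the real direction, and
  \<open>- b\<close> and \<open>a\<close> those in the imaginary direction.
\<close>

lemma stem_function_derivatives:
  fixes \<Phi> :: "complex \<Rightarrow> 'n::{finite,linorder} cliff"
  assumes I: "I \<in> imag_units" and z: "Re z > 0"
    and hol: "\<And>z. Re z > 0 \<Longrightarrow> \<exists>D. (\<Phi> has_derivative (\<lambda>h. cl_act I h D)) (at z)"
  shows "\<exists>a b. ((\<lambda>z. (1/2) *\<^sub>R (\<Phi> (cnj z) + \<Phi> z)) has_derivative (\<lambda>h. Re h *\<^sub>R a - Im h *\<^sub>R b)) (at z) \<and>
     ((\<lambda>z. (1/2) *\<^sub>R (cl_vec I \<odot> (\<Phi> (cnj z) - \<Phi> z))) has_derivative (\<lambda>h. Re h *\<^sub>R b + Im h *\<^sub>R a)) (at z)"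
proof -
  obtain D1 where D1: "(\<Phi> has_derivative (\<lambda>h. cl_act I h D1)) (at z)" using hol[OF z] by blast
  obtain D2 where D2: "(\<Phi> has_derivative (\<lambda>h. cl_act I h D2)) (at (cnj z))" using hol[of "cnj z"] z by auto
  have D2': "((\<lambda>z. \<Phi> (cnj z)) has_derivative (\<lambda>h. cl_act I (cnj h) D2)) (at z)"
    by (rule has_derivative_compose[OF bounded_linear_imp_has_derivative[OF bounded_linear_cnj] D2])
  have act: "cl_act I h x = Re h *\<^sub>R x + Im h *\<^sub>R (cl_vec I \<odot> x)" for h x
    by (simp add: cl_act_def cl_complex_def cl_mult.add_left cl_mult.scaleR_left cl_mult_one)
  define a where "a = (1/2) *\<^sub>R (D2 + D1)"
  define b where "b = (1/2) *\<^sub>R (cl_vec I \<odot> (D2 - D1))"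
  have "((\<lambda>z. (1/2) *\<^sub>R (\<Phi> (cnj z) + \<Phi> z)) has_derivative (\<lambda>h. (1/2) *\<^sub>R (cl_act I (cnj h) D2 + cl_act I h D1))) (at z)"
    by (intro has_derivative_scaleR_right has_derivative_add D1 D2')
  moreover have "(1/2) *\<^sub>R (cl_act I (cnj h) D2 + cl_act I h D1) = Re h *\<^sub>R a - Im h *\<^sub>R b" for h
    by (simp add: act a_def b_def cl_mult.diff_right algebra_simps)
  moreover have "((\<lambda>z. (1/2) *\<^sub>R (cl_vec I \<odot> (\<Phi> (cnj z) - \<Phi> z))) has_derivative
      (\<lambda>h. (1/2) *\<^sub>R (cl_vec I \<odot> (cl_act I (cnj h) D2 - cl_act I h D1)))) (at z)"
    by (intro has_derivative_scaleR_right bounded_linear.has_derivative[OF cl_mult.bounded_linear_right] has_derivative_diff D1 D2')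
  moreover have "(1/2) *\<^sub>R (cl_vec I \<odot> (cl_act I (cnj h) D2 - cl_act I h D1)) = Re h *\<^sub>R b + Im h *\<^sub>R a" for h
    by (simp add: act a_def b_def cl_mult.diff_right cl_mult.add_right cl_mult.scaleR_right cl_mult.minus_right cl_vec_cl_vec[OF I] algebra_simps)
  ultimately show ?thesis by auto
qed

text \<open>
  On the slice of \<open>J\<close> the two partial derivatives are \<open>a + J b\<close> and \<open>- b + J a\<close>, and \<open>J\<close> times the
  second cancels the first. Off the real axis differentiability is the chain rule. At a real point \<open>B\<close>
  vanishes along the axis, so \<open>b = 0\<close>, and to first order \<open>A\<close> and \<open>B\<close> take the values
  \<open>A u + (u' - u) a\<close> and \<open>r a\<close> at \<open>u' + i r\<close>; since \<open>r J\<close> is the vector part of the point, their combination is linear.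
\<close>

lemma slice_monogenic_of_stem:
  fixes f :: "'n::{finite,linorder} paravec \<Rightarrow> 'n cliff"
  assumes stem: "\<And>z. Re z > 0 \<Longrightarrow> \<exists>a b. (A has_derivative (\<lambda>h. Re h *\<^sub>R a - Im h *\<^sub>R b)) (at z) \<and>
      (B has_derivative (\<lambda>h. Re h *\<^sub>R b + Im h *\<^sub>R a)) (at z)"
    and real: "\<And>u. u > 0 \<Longrightarrow> B (of_real u) = 0"
    and f: "\<And>J u v. J \<in> imag_units \<Longrightarrow> u > 0 \<Longrightarrow> f (slice_pt J u v) = A (Complex u v) + cl_vec J \<odot> B (Complex u v)"
  shows "f \<in> slice_monogenic half_space"
proof -
  note [simp] = slice_pt_def
  interpret cv: bounded_linear "cl_vec :: (real, 'n) vec \<Rightarrow> 'n cliff" by (rule bounded_linear_cl_vec)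
  obtain J0 :: "(real, 'n) vec" where J0: "norm J0 = 1" using vector_choose_size[of 1] by auto
  have sgn1: "norm (sgn y) = 1" if "y \<noteq> 0" for y :: "(real, 'n) vec" using that by (simp add: norm_sgn)
  \<comment> \<open>At \<open>y = 0\<close> the value \<open>sgn 0 = 0\<close> is harmless, because \<open>B\<close> vanishes there.\<close>
  have fp: "f (u, y) = A (Complex u (norm y)) + cl_vec (sgn y) \<odot> B (Complex u (norm y))" if u: "u > 0" for u y
  proof (cases "y = 0")
    case True
    then show ?thesis
      using f[of J0 u 0] J0 u real[OF u] by (simp add: imag_units_iff_norm cl_mult.zero_right complex_of_real_def)
  next
    case False
    have "norm y *\<^sub>R sgn y = y" using False by (simp add: sgn_div_norm)
    then show ?thesis
      using f[of "sgn y" u "norm y"] sgn1[OF False] u by (simp add: imag_units_iff_norm)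
  qed
  have diff: "f differentiable (at (u, y))" if u: "u > 0" for u y
  proof (cases "y = 0")
    case False
    let ?c = "\<lambda>x::'n paravec. Complex (fst x) (norm (snd x))"
    have n: "norm differentiable (at (snd (u, y)))" using False by (intro differentiable_norm_at) simp
    have nd: "(\<lambda>x::'n paravec. norm (snd x)) differentiable (at (u, y))"
      using differentiable_compose[of norm snd "(u, y)" UNIV] n by (simp add: bounded_linear_imp_differentiable bounded_linear_snd)
    have c: "?c differentiable (at (u, y))"
      unfolding Complex_eq using nd
      by (intro derivative_intros bounded_linear_imp_differentiable[OF bounded_linear_compose[OF bounded_linear_of_real bounded_linear_fst]]
          differentiable_compose[of of_real] bounded_linear_imp_differentiable[OF bounded_linear_of_real]) auto
    have AB: "A differentiable (at (?c (u, y)))" "B differentiable (at (?c (u, y)))"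
      using stem[of "?c (u, y)"] u by (auto simp: differentiable_def)
    have s: "(\<lambda>x::'n paravec. cl_vec (sgn (snd x))) differentiable (at (u, y))"
      unfolding sgn_div_norm cv.scaleR
      using nd False by (intro differentiable_scaleR differentiable_inverse
        bounded_linear_imp_differentiable[OF bounded_linear_compose[OF bounded_linear_cl_vec bounded_linear_snd]]) auto
    have "(\<lambda>x. A (?c x) + cl_vec (sgn (snd x)) \<odot> B (?c x)) differentiable (at (u, y))"
    proof -
      have A': "(\<lambda>x. A (?c x)) differentiable (at (u, y))" and B': "(\<lambda>x. B (?c x)) differentiable (at (u, y))"
        using differentiable_chain_at[OF c] AB by (auto simp: o_def)
      have "(\<lambda>x. cl_vec (sgn (snd x)) \<odot> B (?c x)) differentiable (at (u, y))"
        using cl_mult.FDERIV s B' unfolding differentiable_def by blast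
      with A' show ?thesis by (rule differentiable_add)
    qed
    moreover have "open {x :: 'n paravec. fst x > 0}"
      by (intro open_Collect_less continuous_intros)
    ultimately show ?thesis
      unfolding differentiable_def
      using has_derivative_transform_within_open[of _ _ "(u, y)" UNIV "{x. fst x > 0}" f] u fp
      by (metis (mono_tags, lifting) mem_Collect_eq fst_conv prod.collapse)
  next
    case True
    have z: "Complex u 0 = of_real u" by (simp add: complex_of_real_def)
    obtain a b where A: "(A has_derivative (\<lambda>h. Re h *\<^sub>R a - Im h *\<^sub>R b)) (at (of_real u))"
        and B: "(B has_derivative (\<lambda>h. Re h *\<^sub>R b + Im h *\<^sub>R a)) (at (of_real u))"
      using stem[of "of_real u"] u by auto
    have "((\<lambda>s. B (of_real s)) has_derivative (\<lambda>h. Re (of_real h) *\<^sub>R b + Im (of_real h) *\<^sub>R a)) (at u)"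
      by (rule has_derivative_compose[OF bounded_linear_imp_has_derivative[OF bounded_linear_of_real] B])
    moreover have "((\<lambda>s. B (of_real s)) has_derivative (\<lambda>h. 0)) (at u)"
      by (rule has_derivative_transform_within_open[OF has_derivative_const[of 0], of "{0<..}"]) (use u real in auto)
    ultimately have "(\<lambda>h::real. Re (of_real h) *\<^sub>R b + Im (of_real h) *\<^sub>R a) = (\<lambda>h. 0)"
      by (rule has_derivative_unique)
    from fun_cong[OF this, of 1] have b0: "b = 0" by simp
    obtain K where K: "K > 0" "\<And>(y :: (real, 'n) vec) X. norm (cl_vec y \<odot> X) \<le> norm y * norm X * K"
      using bounded_bilinear.pos_bounded[OF bounded_bilinear.comp1[OF bounded_bilinear_cl_mult bounded_linear_cl_vec]] by blast
    have "(f has_derivative (\<lambda>h. fst h *\<^sub>R a + cl_vec (snd h) \<odot> a)) (at (u, 0))"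
      unfolding has_derivative_at_alt
    proof (intro conjI allI impI)
      show "bounded_linear (\<lambda>h::'n paravec. fst h *\<^sub>R a + cl_vec (snd h) \<odot> a)"
        by (intro bounded_linear_add bounded_linear_scaleR_const bounded_linear_fst
          bounded_linear_compose[OF cl_mult.bounded_linear_left] bounded_linear_compose[OF bounded_linear_cl_vec bounded_linear_snd])
      fix e :: real assume e: "e > 0"
      define e' where "e' = e / (1 + K)"
      have e': "e' > 0" using e K(1) by (simp add: e'_def)
      obtain d1 where d1: "d1 > 0" "\<And>w. norm (w - of_real u) < d1 \<Longrightarrow>
          norm (A w - A (of_real u) - Re (w - of_real u) *\<^sub>R a) \<le> e' * norm (w - of_real u)"
        using A e' unfolding has_derivative_at_alt b0 by auto
      obtain d2 where d2: "d2 > 0" "\<And>w. norm (w - of_real u) < d2 \<Longrightarrow>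
          norm (B w - Im (w - of_real u) *\<^sub>R a) \<le> e' * norm (w - of_real u)"
        using B e' real[OF u] unfolding has_derivative_at_alt b0 by auto
      show "\<exists>d>0. \<forall>x. norm (x - (u, 0)) < d \<longrightarrow>
          norm (f x - f (u, 0) - (fst (x - (u, 0)) *\<^sub>R a + cl_vec (snd (x - (u, 0))) \<odot> a)) \<le> e * norm (x - (u, 0))"
      proof (intro exI conjI allI impI)
        show "min u (min d1 d2) > 0" using u d1 d2 by simp
        fix x :: "'n paravec"
        assume x: "norm (x - (u, 0)) < min u (min d1 d2)"
        obtain u' y where xy: "x = (u', y)" by (cases x)
        let ?w = "Complex u' (norm y)"
        have nw: "norm (?w - of_real u) = norm (x - (u, 0))"
          by (simp add: xy norm_Pair cmod_def)
        have "\<bar>u' - u\<bar> \<le> norm (x - (u, 0))"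
          using norm_fst_le[of "u' - u" y] by (simp add: xy)
        then have u': "u' > 0" using x by linarith
        have y: "cl_vec y = norm y *\<^sub>R cl_vec (sgn y)"
          by (cases "y = 0") (simp_all add: cv.scaleR[symmetric] cv.zero sgn_div_norm)
        have "f x - f (u, 0) - (fst (x - (u, 0)) *\<^sub>R a + cl_vec (snd (x - (u, 0))) \<odot> a)
           = (A ?w - A (of_real u) - (u' - u) *\<^sub>R a) + cl_vec (sgn y) \<odot> (B ?w - norm y *\<^sub>R a)"
          using fp[OF u', of y] fp[OF u, of 0]
          by (simp add: xy z y cl_mult.diff_right cl_mult.scaleR_left cl_mult.scaleR_right cl_mult.zero_left cv.zero)
        also have "norm \<dots> \<le> e' * norm (?w - of_real u) + e' * norm (?w - of_real u) * K"
        proof (rule norm_triangle_le[OF add_mono])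
          show "norm (A ?w - A (of_real u) - (u' - u) *\<^sub>R a) \<le> e' * norm (?w - of_real u)"
            using d1(2)[of ?w] x nw by simp
          have "norm (cl_vec (sgn y) \<odot> (B ?w - norm y *\<^sub>R a)) \<le> norm (sgn y) * norm (B ?w - norm y *\<^sub>R a) * K"
            by (rule K)
          also have "\<dots> \<le> 1 * norm (B ?w - norm y *\<^sub>R a) * K"
            using K(1) by (intro mult_right_mono) (auto simp: norm_sgn)
          also have "\<dots> \<le> e' * norm (?w - of_real u) * K"
            using d2(2)[of ?w] x nw K(1) by (intro mult_right_mono) auto
          finally show "norm (cl_vec (sgn y) \<odot> (B ?w - norm y *\<^sub>R a)) \<le> e' * norm (?w - of_real u) * K" .
        qed
        also have "\<dots> = e' * (1 + K) * norm (x - (u, 0))" unfolding nw by (simp add: algebra_simps)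
        also have "e' * (1 + K) = e" using K(1) by (simp add: e'_def)
        finally show "norm (f x - f (u, 0) - (fst (x - (u, 0)) *\<^sub>R a + cl_vec (snd (x - (u, 0))) \<odot> a)) \<le> e * norm (x - (u, 0))" .
      qed
    qed
    then show ?thesis using True by (auto simp: differentiable_def)
  qed
  have cr: "vector_derivative (\<lambda>s. f (slice_pt J s v)) (at u)
      + cl_vec J \<odot> vector_derivative (\<lambda>t. f (slice_pt J u t)) (at v) = 0"
    if J: "J \<in> imag_units" and u: "u > 0" for J u v
  proof -
    obtain a b where A: "(A has_derivative (\<lambda>h. Re h *\<^sub>R a - Im h *\<^sub>R b)) (at (Complex u v))"
        and B: "(B has_derivative (\<lambda>h. Re h *\<^sub>R b + Im h *\<^sub>R a)) (at (Complex u v))"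
      using stem[of "Complex u v"] u by auto
    have path: "((\<lambda>s. A (p s) + cl_vec J \<odot> B (p s)) has_vector_derivative
        (Re w *\<^sub>R a - Im w *\<^sub>R b) + cl_vec J \<odot> (Re w *\<^sub>R b + Im w *\<^sub>R a)) (at s)"
      if p: "(p has_vector_derivative w) (at s)" "p s = Complex u v" for p :: "real \<Rightarrow> complex" and w s
    proof -
      have p': "(p has_derivative (\<lambda>h. h *\<^sub>R w)) (at s)" using p(1) by (simp add: has_vector_derivative_def)
      have "((\<lambda>s. A (p s) + cl_vec J \<odot> B (p s)) has_derivative
        (\<lambda>h. (Re (h *\<^sub>R w) *\<^sub>R a - Im (h *\<^sub>R w) *\<^sub>R b) + cl_vec J \<odot> (Re (h *\<^sub>R w) *\<^sub>R b + Im (h *\<^sub>R w) *\<^sub>R a))) (at s)"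
        by (intro has_derivative_add bounded_linear.has_derivative[OF cl_mult.bounded_linear_right]
          has_derivative_compose[OF p', of A, unfolded p(2)] has_derivative_compose[OF p', of B, unfolded p(2)] A B)
      moreover have "(Re (h *\<^sub>R w) *\<^sub>R a - Im (h *\<^sub>R w) *\<^sub>R b) + cl_vec J \<odot> (Re (h *\<^sub>R w) *\<^sub>R b + Im (h *\<^sub>R w) *\<^sub>R a)
         = h *\<^sub>R ((Re w *\<^sub>R a - Im w *\<^sub>R b) + cl_vec J \<odot> (Re w *\<^sub>R b + Im w *\<^sub>R a))" for h
        by (simp add: cl_mult.add_right cl_mult.scaleR_right algebra_simps)
      ultimately show ?thesis by (simp add: has_vector_derivative_def)
    qed
    have "((\<lambda>s. Complex s v) has_vector_derivative 1) (at u)"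
      unfolding Complex_eq by (auto intro!: derivative_eq_intros)
    from path[OF this] have "((\<lambda>s. f (slice_pt J s v)) has_vector_derivative a + cl_vec J \<odot> b) (at u)"
      by (rule_tac has_vector_derivative_transform_within_open[where S="{0<..}"]) (use u f[OF J] in auto)
    moreover have "((\<lambda>t. Complex u t) has_vector_derivative \<i>) (at v)"
      unfolding Complex_eq by (auto intro!: derivative_eq_intros)
    from path[OF this] have "((\<lambda>t. f (slice_pt J u t)) has_vector_derivative - b + cl_vec J \<odot> a) (at v)"
      using f[OF J u] by simp
    ultimately show ?thesis
      using cl_vec_cl_vec[OF J, of a]
      by (simp add: vector_derivative_at cl_mult.add_right cl_mult.minus_right cl_mult.diff_right del: slice_pt_def)
  qed
  show ?thesis
    unfolding slice_monogenic_def
  proof (intro CollectI conjI ballI allI impI)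
    fix x :: "'n paravec" assume "x \<in> half_space"
    then show "f differentiable (at x)" using diff by (auto simp: half_space_def)
  next
    fix J :: "(real, 'n) vec" and u v assume "J \<in> imag_units" "slice_pt J u v \<in> half_space"
    then show "(1/2) *\<^sub>R (vector_derivative (\<lambda>s. f (slice_pt J s v)) (at u)
          + cl_vec J \<odot> vector_derivative (\<lambda>t. f (slice_pt J u t)) (at v)) = 0"
      using cr[of J u v] by (auto simp: half_space_def)
  qed
qed

section \<open>Non-tangential limits of Poisson integrals\<close>

lemma Lp_locally_integrable:
  assumes p: "1 \<le> p" and g: "g \<in> Lp p"
  shows "(\<integral>\<^sup>+x\<in>ball 0 (real N). norm (g x) \<partial>lborel) < \<infinity>"
proof -
  have y: "y \<le> 1 + y powr p" if "y \<ge> 0" for y :: real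
  proof (cases "y \<ge> 1")
    case True
    then show ?thesis using powr_mono[OF p, of y] by simp
  next
    case False
    moreover have "0 \<le> y powr p" by simp
    ultimately show ?thesis by linarith
  qed
  have [measurable]: "g \<in> borel_measurable lebesgue" and i: "integrable lebesgue (\<lambda>x. norm (g x) powr p)"
    using g by (auto simp: Lp_def)
  have [measurable]: "ball 0 (real N) \<in> sets lebesgue" by simp
  have "(\<integral>\<^sup>+x\<in>ball 0 (real N). norm (g x) \<partial>lborel) = (\<integral>\<^sup>+x\<in>ball 0 (real N). norm (g x) \<partial>lebesgue)"
    by (simp only: nn_integral_completion)
  also have "\<dots> \<le> (\<integral>\<^sup>+x. indicator (ball 0 (real N)) x + ennreal (norm (g x) powr p) \<partial>lebesgue)"
  proof (intro nn_integral_mono)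
    fix x
    have "ennreal (norm (g x)) \<le> ennreal (1 + norm (g x) powr p)" by (intro ennreal_leI y) simp
    also have "\<dots> = 1 + ennreal (norm (g x) powr p)" by simp
    finally show "ennreal (norm (g x)) * indicator (ball 0 (real N)) x \<le> indicator (ball 0 (real N)) x + ennreal (norm (g x) powr p)"
      by (simp add: indicator_def)
  qed
  also have "\<dots> = emeasure lebesgue (ball (0::real) (real N)) + (\<integral>\<^sup>+x. ennreal (norm (g x) powr p) \<partial>lebesgue)"
    by (subst nn_integral_add) auto
  also have "\<dots> < \<infinity>"
    using emeasure_bounded_finite[of "ball (0::real) (real N)"] nn_integral_eq_integral[OF i] by simp
  finally show ?thesis .
qed

text \<open>
  A radial majorant built from indicators of balls of radius \<open>2\<^sup>j u\<close>, which turns Poisson averages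
  into sums of ordinary averages.
\<close>

lemma poisson_kernel_le_dyadic:
  assumes u: "u > 0"
  shows "ennreal (u / (u\<^sup>2 + t\<^sup>2)) \<le> (\<Sum>j. ennreal (4 * (1/4) ^ j / u) * indicator (ball 0 (2 ^ j * u)) t)"
proof -
  \<comment> \<open>Among the balls of radius \<open>2\<^sup>j u\<close>, the smallest one that contains \<open>t\<close> already dominates the kernel at \<open>t\<close>.\<close>
  define m where "m = (LEAST j. \<bar>t\<bar> < 2 ^ j * u)"
  have ex: "\<exists>j::nat. \<bar>t\<bar> < 2 ^ j * u"
    using real_arch_pow[of 2 "\<bar>t\<bar> / u"] u by (auto simp: field_simps)
  have m: "\<bar>t\<bar> < 2 ^ m * u" unfolding m_def by (rule LeastI_ex[OF ex])
  have sq: "u\<^sup>2 + t\<^sup>2 > 0" using u by (simp add: add_pos_nonneg)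
  have "u / (u\<^sup>2 + t\<^sup>2) \<le> 4 * (1/4) ^ m / u"
  proof (cases m)
    case 0
    have "u / (u\<^sup>2 + t\<^sup>2) \<le> u / u\<^sup>2" using u sq by (intro divide_left_mono) auto
    also have "\<dots> \<le> 4 / u" using u by (simp add: field_simps power2_eq_square)
    finally show ?thesis using 0 by simp
  next
    case (Suc n)
    then have "\<not> \<bar>t\<bar> < 2 ^ n * u" using not_less_Least[of n "\<lambda>j. \<bar>t\<bar> < 2 ^ j * u"] by (simp add: m_def)
    then have "(2 ^ n * u)\<^sup>2 \<le> \<bar>t\<bar>\<^sup>2" using u by (intro power_mono) auto
    then have "(2 ^ n * u)\<^sup>2 \<le> u\<^sup>2 + t\<^sup>2" by (simp add: add_increasing)
    then have "u / (u\<^sup>2 + t\<^sup>2) \<le> u / (2 ^ n * u)\<^sup>2" using u sq by (intro divide_left_mono) auto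
    also have "\<dots> = 4 * (1/4) ^ m / u"
    proof -
      have "(4::real) ^ n = 2 ^ n * 2 ^ n" by (simp add: power_mult_distrib[symmetric])
      then show ?thesis using u Suc by (simp add: power_mult_distrib power2_eq_square field_simps)
    qed
    finally show ?thesis .
  qed
  then have "ennreal (u / (u\<^sup>2 + t\<^sup>2)) \<le> ennreal (4 * (1/4) ^ m / u) * indicator (ball 0 (2 ^ m * u)) t"
    using m by (simp add: ennreal_leI)
  also have "\<dots> \<le> (\<Sum>j. ennreal (4 * (1/4) ^ j / u) * indicator (ball 0 (2 ^ j * u)) t)"
  proof -
    have "F m \<le> suminf F" for F :: "nat \<Rightarrow> ennreal" using sum_le_suminf[of F "{m}"] by simp
    then show ?thesis .
  qed
  finally show ?thesis .
qed

text \<open>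
  The ball of radius \<open>2\<^sup>j u\<close> contributes at most \<open>4 e / 2\<^sup>j\<close>, whatever \<open>u\<close> is.
\<close>

lemma poisson_average_near:
  fixes k :: "real \<Rightarrow> ennreal"
  assumes u: "u > 0" and k [measurable]: "k \<in> borel_measurable lebesgue"
    and avg: "\<And>r. r > 0 \<Longrightarrow> (\<integral>\<^sup>+t\<in>ball x r. k t \<partial>lebesgue) \<le> ennreal (e * r)" and e: "e \<ge> 0"
  shows "(\<integral>\<^sup>+w. ennreal (u / (u\<^sup>2 + (x - w)\<^sup>2)) * k w \<partial>lebesgue) \<le> ennreal (8 * e)"
proof -
  have [measurable]: "ball x r \<in> sets lebesgue" for x r :: real by simp
  have ind: "indicator (ball 0 r) (x - w) = (indicator (ball x r) w :: ennreal)" for r w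
    by (simp add: indicator_def dist_real_def abs_minus_commute)
  have "(\<integral>\<^sup>+w. ennreal (u / (u\<^sup>2 + (x - w)\<^sup>2)) * k w \<partial>lebesgue)
     \<le> (\<integral>\<^sup>+w. (\<Sum>j. ennreal (4 * (1/4) ^ j / u) * (k w * indicator (ball x (2 ^ j * u)) w)) \<partial>lebesgue)"
  proof (intro nn_integral_mono)
    fix w
    have "ennreal (u / (u\<^sup>2 + (x - w)\<^sup>2)) * k w \<le> (\<Sum>j. ennreal (4 * (1/4) ^ j / u) * indicator (ball x (2 ^ j * u)) w) * k w"
      using poisson_kernel_le_dyadic[OF u, of "x - w"] unfolding ind by (intro mult_right_mono) auto
    also have "\<dots> = (\<Sum>j. ennreal (4 * (1/4) ^ j / u) * indicator (ball x (2 ^ j * u)) w * k w)"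
      by (rule ennreal_suminf_multc[symmetric])
    finally show "ennreal (u / (u\<^sup>2 + (x - w)\<^sup>2)) * k w \<le> (\<Sum>j. ennreal (4 * (1/4) ^ j / u) * (k w * indicator (ball x (2 ^ j * u)) w))"
      by (simp only: mult_ac)
  qed
  also have "\<dots> = (\<Sum>j. ennreal (4 * (1/4) ^ j / u) * (\<integral>\<^sup>+w\<in>ball x (2 ^ j * u). k w \<partial>lebesgue))"
    by (subst nn_integral_suminf) (auto simp: nn_integral_cmult)
  also have "\<dots> \<le> (\<Sum>j. ennreal (4 * e * (1/2) ^ j))"
  proof (intro suminf_le summableI)
    fix j :: nat
    have "ennreal (4 * (1/4) ^ j / u) * (\<integral>\<^sup>+w\<in>ball x (2 ^ j * u). k w \<partial>lebesgue) \<le> ennreal (4 * (1/4) ^ j / u) * ennreal (e * (2 ^ j * u))"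
      using u by (intro mult_left_mono avg) auto
    also have "\<dots> = ennreal (4 * (1/4) ^ j / u * (e * (2 ^ j * u)))"
      using u e by (intro ennreal_mult[symmetric]) auto
    also have "4 * (1/4) ^ j / u * (e * (2 ^ j * u)) = 4 * e * (1/2) ^ j"
    proof -
      have "(1/4::real) ^ j * 2 ^ j = (1/2) ^ j" by (simp add: power_mult_distrib[symmetric])
      then show ?thesis using u by (simp add: field_simps)
    qed
    finally show "ennreal (4 * (1/4) ^ j / u) * (\<integral>\<^sup>+w\<in>ball x (2 ^ j * u). k w \<partial>lebesgue) \<le> ennreal (4 * e * (1/2) ^ j)" .
  qed
  also have "\<dots> = ennreal (\<Sum>j. 4 * e * (1/2) ^ j)"
    using e by (intro suminf_ennreal2 summable_mult summable_geometric) auto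
  also have "(\<Sum>j. 4 * e * (1/2::real) ^ j) = 8 * e"
    by (subst suminf_mult) (auto simp: suminf_geometric)
  finally show ?thesis .
qed

text \<open>
  Inside a cone the kernel centred at \<open>v\<close> is at most a constant times the one centred at \<open>x\<close>, so it
  suffices to average \<open>\<bar>g - g x\<bar>\<close> against the latter. Near \<open>x\<close> the averages are small because \<open>x\<close> is a
  Lebesgue point; away from \<open>x\<close> the kernel is \<open>u\<close> times a fixed integrable majorant.
\<close>

lemma poisson_integral_nontangential_limit:
  fixes g :: "real \<Rightarrow> 'b::euclidean_space"
  assumes p: "1 \<le> p" "p \<le> 2" and g: "g \<in> Lp p"
    and lp: "\<And>e. e > 0 \<Longrightarrow> \<exists>d>0. \<forall>r. 0 < r \<longrightarrow> r < d \<longrightarrow>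
       (\<integral>\<^sup>+y\<in>ball x r. norm (g y - g x) \<partial>lborel) \<le> ennreal (e * r)"
    and \<alpha>: "\<alpha> > 0"
  shows "((\<lambda>(u, v). LINT w|lebesgue. poisson_kernel u (v - w) *\<^sub>R g w) \<longlongrightarrow> g x)
        (at (0, x) within {(u, v). u > 0 \<and> \<bar>v - x\<bar> < \<alpha> * u})"
proof -
  have gm [measurable]: "g \<in> borel_measurable lebesgue" and gi: "integrable lebesgue (\<lambda>w. norm (g w) powr p)"
    using g by (auto simp: Lp_def)
  have [measurable]: "ball x r \<in> sets lebesgue" for x r :: real by simp
  \<comment> \<open>The factor by which the kernel grows when its centre moves inside the cone of aperture \<open>\<alpha>\<close>.\<close>
  define A where "A = 2 + 2 * \<alpha>\<^sup>2"
  have A: "A > 0" unfolding A_def by (simp add: add_pos_nonneg)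
  define k where "k w = norm (g w - g x)" for w
  have k0: "k w \<ge> 0" for w by (simp add: k_def)
  have km [measurable]: "k \<in> borel_measurable lebesgue" unfolding k_def by measurable
  have Q: "integrable lebesgue (\<lambda>w. 1 / (d\<^sup>2 + (x - w)\<^sup>2) * k w)" if d: "d > 0" for d
  proof -
    let ?q = "\<lambda>w. 1 / (d\<^sup>2 + (x - w)\<^sup>2)"
    have q: "0 \<le> ?q w" "?q w \<le> 1 / d\<^sup>2" for w
      using d by simp (intro frac_le, use d in auto)
    have [measurable]: "?q \<in> borel_measurable lebesgue" by (rule measurable_completion) simp
    have "integrable lebesgue (\<lambda>w. (1 / d\<^sup>2 + 1) * norm (g w) powr p + 1 / d\<^sup>2 * ?q w + norm (g x) * ?q w)"
      using gi inverse_quadratic_integral(1)[OF d, of x] by (intro Bochner_Integration.integrable_add integrable_mult_right)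
    then show ?thesis
    proof (rule Bochner_Integration.integrable_bound)
      show "(\<lambda>w. ?q w * k w) \<in> borel_measurable lebesgue" by measurable
      have "norm (?q w * k w) \<le> norm ((1 / d\<^sup>2 + 1) * norm (g w) powr p + 1 / d\<^sup>2 * ?q w + norm (g x) * ?q w)" for w
      proof -
        have "?q w * k w \<le> ?q w * (norm (g w) + norm (g x))"
          unfolding k_def using q(1) by (intro mult_left_mono norm_triangle_ineq4)
        also have "\<dots> = ?q w * norm (g w) + norm (g x) * ?q w"
          by (simp only: distrib_left mult.commute[of "norm (g x)"])
        also have "?q w * norm (g w) \<le> (1 / d\<^sup>2 + 1) * norm (g w) powr p + (?q w)\<^sup>2"
          using q by (intro kernel_young[OF p]) auto
        also have "(?q w)\<^sup>2 \<le> 1 / d\<^sup>2 * ?q w"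
          unfolding power2_eq_square[of "?q w"] using q by (intro mult_right_mono) auto
        finally have "?q w * k w \<le> (1 / d\<^sup>2 + 1) * norm (g w) powr p + 1 / d\<^sup>2 * ?q w + norm (g x) * ?q w" by simp
        then show ?thesis using q(1)[of w] k0[of w] by (simp add: abs_mult)
      qed
      then show "AE w in lebesgue. norm (?q w * k w) \<le> norm ((1 / d\<^sup>2 + 1) * norm (g w) powr p + 1 / d\<^sup>2 * ?q w + norm (g x) * ?q w)"
        by (rule AE_I2)
    qed
  qed
  have bound: "norm ((LINT w|lebesgue. poisson_kernel u (v - w) *\<^sub>R g w) - g x)
      \<le> A * (LINT w|lebesgue. u / (u\<^sup>2 + (x - w)\<^sup>2) * k w)"
    if u: "u > 0" and v: "\<bar>v - x\<bar> < \<alpha> * u" for u v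
  proof -
    have P: "poisson_kernel u (v - w) = u / pi * (1 / (u\<^sup>2 + (v - w)\<^sup>2))" for w
      by (simp add: poisson_kernel_eq[OF u])
    have Pm [measurable]: "(\<lambda>w. poisson_kernel u (v - w)) \<in> borel_measurable lebesgue"
      unfolding P by (rule measurable_completion) simp
    have Pi: "integrable lebesgue (\<lambda>w. poisson_kernel u (v - w))"
      unfolding P using inverse_quadratic_integral(1)[OF u] by (rule integrable_mult_right)
    have P1: "(LINT w|lebesgue. poisson_kernel u (v - w)) = 1"
    proof -
      have "(LINT w|lebesgue. poisson_kernel u (v - w)) = u / pi * (pi / u)"
        by (simp only: P integral_mult_right_zero inverse_quadratic_integral(2)[OF u])
      then show ?thesis using u by simp
    qed
    have le: "poisson_kernel u (v - w) \<le> A * (u / (u\<^sup>2 + (x - w)\<^sup>2))" for w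
    proof -
      have pos: "u\<^sup>2 + (v - w)\<^sup>2 > 0" "u\<^sup>2 + (x - w)\<^sup>2 > 0" using u by (simp_all add: add_pos_nonneg)
      have "\<bar>v - x\<bar>\<^sup>2 \<le> (\<alpha> * u)\<^sup>2" using v by (intro power_mono) auto
      moreover have "(x - w)\<^sup>2 \<le> 2 * (v - w)\<^sup>2 + 2 * (v - x)\<^sup>2"
      proof -
        have "0 \<le> ((v - w) + (v - x))\<^sup>2" by simp
        then show ?thesis by (simp add: power2_eq_square algebra_simps)
      qed
      ultimately have "u\<^sup>2 + (x - w)\<^sup>2 \<le> u\<^sup>2 + 2 * (v - w)\<^sup>2 + 2 * (\<alpha>\<^sup>2 * u\<^sup>2)"
        by (simp add: power_mult_distrib)
      also have "\<dots> \<le> A * (u\<^sup>2 + (v - w)\<^sup>2)"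
        unfolding A_def by (simp add: algebra_simps)
      finally have "u * (u\<^sup>2 + (x - w)\<^sup>2) \<le> u * (A * (u\<^sup>2 + (v - w)\<^sup>2))" using u by (intro mult_left_mono) auto
      then have "u / (u\<^sup>2 + (v - w)\<^sup>2) \<le> A * (u / (u\<^sup>2 + (x - w)\<^sup>2))"
        using pos by (simp add: divide_simps mult_ac)
      moreover have "poisson_kernel u (v - w) \<le> u / (u\<^sup>2 + (v - w)\<^sup>2)"
        unfolding P using u pos pi_gt3 by (simp add: divide_simps) 
      ultimately show ?thesis by linarith
    qed
    have P0: "poisson_kernel u (v - w) \<ge> 0" for w unfolding P using u by simp
    have Ii: "integrable lebesgue (\<lambda>w. A * (u / (u\<^sup>2 + (x - w)\<^sup>2) * k w))"
      using integrable_mult_right[OF Q[OF u], of "A * u"] by (simp add: mult_ac)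
    have normle: "norm (poisson_kernel u (v - w) *\<^sub>R (g w - g x)) \<le> A * (u / (u\<^sup>2 + (x - w)\<^sup>2) * k w)" for w
    proof -
      have "norm (poisson_kernel u (v - w) *\<^sub>R (g w - g x)) = poisson_kernel u (v - w) * k w"
        using P0[of w] by (simp add: k_def)
      also have "\<dots> \<le> A * (u / (u\<^sup>2 + (x - w)\<^sup>2)) * k w" by (rule mult_right_mono[OF le k0])
      also have "\<dots> = A * (u / (u\<^sup>2 + (x - w)\<^sup>2) * k w)" by (rule mult.assoc)
      finally show ?thesis .
    qed
    have di: "integrable lebesgue (\<lambda>w. poisson_kernel u (v - w) *\<^sub>R (g w - g x))"
    proof (rule Bochner_Integration.integrable_bound[OF Ii])
      show "(\<lambda>w. poisson_kernel u (v - w) *\<^sub>R (g w - g x)) \<in> borel_measurable lebesgue" by measurable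
      show "AE w in lebesgue. norm (poisson_kernel u (v - w) *\<^sub>R (g w - g x)) \<le> norm (A * (u / (u\<^sup>2 + (x - w)\<^sup>2) * k w))"
        using order_trans[OF normle abs_ge_self] by (intro AE_I2) (simp only: real_norm_def)
    qed
    have ci: "integrable lebesgue (\<lambda>w. poisson_kernel u (v - w) *\<^sub>R g x)"
      using Pi by (rule integrable_scaleR_left) 
    have "(LINT w|lebesgue. poisson_kernel u (v - w) *\<^sub>R g w)
        = (LINT w|lebesgue. poisson_kernel u (v - w) *\<^sub>R (g w - g x) + poisson_kernel u (v - w) *\<^sub>R g x)"
      by (simp add: algebra_simps)
    also have "\<dots> = (LINT w|lebesgue. poisson_kernel u (v - w) *\<^sub>R (g w - g x)) + g x"
      using di ci P1 Pi by simp
    finally have "norm ((LINT w|lebesgue. poisson_kernel u (v - w) *\<^sub>R g w) - g x)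
        = norm (LINT w|lebesgue. poisson_kernel u (v - w) *\<^sub>R (g w - g x))" by simp
    also have "\<dots> \<le> (LINT w|lebesgue. norm (poisson_kernel u (v - w) *\<^sub>R (g w - g x)))"
      by (rule integral_norm_bound)
    also have "\<dots> \<le> (LINT w|lebesgue. A * (u / (u\<^sup>2 + (x - w)\<^sup>2) * k w))"
      by (rule integral_mono[OF integrable_norm[OF di] Ii normle])
    finally show ?thesis by (simp only: integral_mult_right_zero)
  qed
  have small: "\<exists>d>0. \<forall>u. 0 < u \<longrightarrow> u < d \<longrightarrow> (LINT w|lebesgue. u / (u\<^sup>2 + (x - w)\<^sup>2) * k w) \<le> e" if e: "e > 0" for e
  proof -
    define e' where "e' = e / 16"
    have e': "e' > 0" using e by (simp add: e'_def)
    obtain d0 where d0: "d0 > 0" "\<And>r. 0 < r \<Longrightarrow> r < d0 \<Longrightarrow> (\<integral>\<^sup>+y\<in>ball x r. k y \<partial>lborel) \<le> ennreal (e' * r)"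
      using lp[OF e'] unfolding k_def by blast
    define d where "d = d0 / 2"
    have d: "d > 0" "d < d0" using d0 by (auto simp: d_def)
    define T where "T = 2 * (LINT w|lebesgue. 1 / (d\<^sup>2 + (x - w)\<^sup>2) * k w)"
    have T: "T \<ge> 0" unfolding T_def using k0 by (intro mult_nonneg_nonneg integral_nonneg_AE AE_I2) auto
    have main: "(LINT w|lebesgue. u / (u\<^sup>2 + (x - w)\<^sup>2) * k w) \<le> 8 * e' + u * T" if u: "u > 0" for u
    proof -
      \<comment> \<open>Outside \<open>ball x d\<close> the kernel is compared with the one at the fixed height \<open>d\<close>.\<close>
      let ?near = "\<lambda>w. ennreal (u / (u\<^sup>2 + (x - w)\<^sup>2)) * (ennreal (k w) * indicator (ball x d) w)"
      let ?far = "\<lambda>w. ennreal (u * (2 * (1 / (d\<^sup>2 + (x - w)\<^sup>2) * k w)))"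
      have i: "integrable lebesgue (\<lambda>w. u / (u\<^sup>2 + (x - w)\<^sup>2) * k w)"
        using integrable_mult_right[OF Q[OF u], of u] by (simp add: mult_ac)
      have fi: "integrable lebesgue (\<lambda>w. u * (2 * (1 / (d\<^sup>2 + (x - w)\<^sup>2) * k w)))"
        by (intro integrable_mult_right Q d)
      have "ennreal (LINT w|lebesgue. u / (u\<^sup>2 + (x - w)\<^sup>2) * k w) = (\<integral>\<^sup>+w. ennreal (u / (u\<^sup>2 + (x - w)\<^sup>2) * k w) \<partial>lebesgue)"
        using i u k0 by (intro nn_integral_eq_integral[symmetric]) auto
      also have "\<dots> \<le> (\<integral>\<^sup>+w. ?near w + ?far w \<partial>lebesgue)"
      proof (intro nn_integral_mono)
        fix w
        show "ennreal (u / (u\<^sup>2 + (x - w)\<^sup>2) * k w) \<le> ?near w + ?far w"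
        proof (cases "w \<in> ball x d")
          case True
          then have near: "?near w = ennreal (u / (u\<^sup>2 + (x - w)\<^sup>2)) * ennreal (k w)" by simp
          have "ennreal (u / (u\<^sup>2 + (x - w)\<^sup>2) * k w) = ?near w"
            unfolding near using u k0 by (intro ennreal_mult) auto
          also have "\<dots> \<le> ?near w + ?far w" by (rule add_increasing2[OF zero_le order_refl])
          finally show ?thesis .
        next
          case False
          then have "d \<le> \<bar>x - w\<bar>" by (simp add: dist_norm)
          then have "d\<^sup>2 \<le> \<bar>x - w\<bar>\<^sup>2" using d by (intro power_mono) auto
          then have dx: "d\<^sup>2 + (x - w)\<^sup>2 \<le> 2 * (u\<^sup>2 + (x - w)\<^sup>2)"
          proof -
            have "d\<^sup>2 + (x - w)\<^sup>2 \<le> (x - w)\<^sup>2 + (x - w)\<^sup>2"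
              using \<open>d\<^sup>2 \<le> \<bar>x - w\<bar>\<^sup>2\<close> by simp
            also have "\<dots> \<le> 2 * (u\<^sup>2 + (x - w)\<^sup>2)" by simp
            finally show ?thesis .
          qed
          have pos: "d\<^sup>2 + (x - w)\<^sup>2 > 0" "u\<^sup>2 + (x - w)\<^sup>2 > 0" using u d by (simp_all add: add_pos_nonneg)
          have "1 / (u\<^sup>2 + (x - w)\<^sup>2) \<le> 2 * (1 / (d\<^sup>2 + (x - w)\<^sup>2))"
            using dx pos by (simp add: divide_simps)
          then have "u * (1 / (u\<^sup>2 + (x - w)\<^sup>2)) * k w \<le> u * (2 * (1 / (d\<^sup>2 + (x - w)\<^sup>2))) * k w"
            using u k0 by (intro mult_right_mono mult_left_mono) auto
          then have "ennreal (u / (u\<^sup>2 + (x - w)\<^sup>2) * k w) \<le> ?far w"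
            by (intro ennreal_leI) (simp add: mult_ac)
          then show ?thesis by (simp add: add_increasing)
        qed
      qed
      also have "\<dots> = (\<integral>\<^sup>+w. ?near w \<partial>lebesgue) + (\<integral>\<^sup>+w. ?far w \<partial>lebesgue)"
      proof (rule nn_integral_add)
        have "(\<lambda>w. u / (u\<^sup>2 + (x - w)\<^sup>2)) \<in> borel_measurable lebesgue" by (rule measurable_completion) simp
        then show "?near \<in> borel_measurable lebesgue" by measurable
        show "?far \<in> borel_measurable lebesgue" using borel_measurable_integrable[OF fi] by measurable
      qed
      also have "(\<integral>\<^sup>+w. ?near w \<partial>lebesgue) \<le> ennreal (8 * e')"
      proof (rule poisson_average_near[OF u])
        show "(\<lambda>w. ennreal (k w) * indicator (ball x d) w) \<in> borel_measurable lebesgue" by measurable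
        fix r :: real assume r: "r > 0"
        have "(\<integral>\<^sup>+t. ennreal (k t) * indicator (ball x d) t * indicator (ball x r) t \<partial>lebesgue)
            \<le> (\<integral>\<^sup>+t\<in>ball x (min r d). k t \<partial>lebesgue)"
          by (intro nn_integral_mono) (auto simp: indicator_def)
        also have "\<dots> = (\<integral>\<^sup>+t\<in>ball x (min r d). k t \<partial>lborel)" by (simp only: nn_integral_completion)
        also have "\<dots> \<le> ennreal (e' * min r d)" using r d by (intro d0) auto
        also have "\<dots> \<le> ennreal (e' * r)" using e' by (intro ennreal_leI mult_left_mono) auto
        finally show "(\<integral>\<^sup>+t. ennreal (k t) * indicator (ball x d) t * indicator (ball x r) t \<partial>lebesgue) \<le> ennreal (e' * r)" .
      qed (use e' in simp)
      also have "(\<integral>\<^sup>+w. ?far w \<partial>lebesgue) = ennreal (u * T)"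
      proof -
        have "(\<integral>\<^sup>+w. ?far w \<partial>lebesgue) = ennreal (LINT w|lebesgue. u * (2 * (1 / (d\<^sup>2 + (x - w)\<^sup>2) * k w)))"
          using u k0 by (intro nn_integral_eq_integral[OF fi]) auto
        then show ?thesis by (simp only: integral_mult_right_zero T_def)
      qed
      also have "ennreal (8 * e') + ennreal (u * T) = ennreal (8 * e' + u * T)" using e' u T by simp
      finally have "ennreal (LINT w|lebesgue. u / (u\<^sup>2 + (x - w)\<^sup>2) * k w) \<le> ennreal (8 * e' + u * T)" by (simp add: add_right_mono)
      then show ?thesis using e' u T by (subst (asm) ennreal_le_iff) auto
    qed
    show ?thesis
    proof (intro exI conjI allI impI)
      show "e / 2 / (T + 1) > 0" using e T by simp
      fix u assume u: "0 < u" "u < e / 2 / (T + 1)"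
      have "u * T \<le> u * (T + 1)" using u by simp
      also have "\<dots> \<le> e / 2 / (T + 1) * (T + 1)" using u T by (intro mult_right_mono) auto
      also have "\<dots> = e / 2"
        by (rule nonzero_eq_divide_eq[THEN iffD1, OF _ refl]) (use T in auto)
      finally show "(LINT w|lebesgue. u / (u\<^sup>2 + (x - w)\<^sup>2) * k w) \<le> e"
        using main[OF u(1)] by (simp add: e'_def)
    qed
  qed
  show ?thesis
  proof (rule tendstoI)
    fix e :: real assume e: "e > 0"
    obtain d where d: "d > 0" "\<And>u. 0 < u \<Longrightarrow> u < d \<Longrightarrow> (LINT w|lebesgue. u / (u\<^sup>2 + (x - w)\<^sup>2) * k w) \<le> e / (2 * A)"
      using small[of "e / (2 * A)"] e A by auto
    show "\<forall>\<^sub>F y in at (0, x) within {(u, v). u > 0 \<and> \<bar>v - x\<bar> < \<alpha> * u}.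
        dist (case y of (u, v) \<Rightarrow> LINT w|lebesgue. poisson_kernel u (v - w) *\<^sub>R g w) (g x) < e"
      unfolding eventually_at
    proof (intro exI conjI ballI impI)
      show "d > 0" by (rule d)
      fix y assume y: "y \<in> {(u, v). u > 0 \<and> \<bar>v - x\<bar> < \<alpha> * u}" "y \<noteq> (0, x) \<and> dist y (0, x) < d"
      obtain u v where uv: "y = (u, v)" by (cases y)
      have "\<bar>u\<bar> \<le> dist y (0, x)" using dist_fst_le[of y "(0, x)"] by (simp add: uv dist_norm)
      then have u: "u > 0" "u < d" "\<bar>v - x\<bar> < \<alpha> * u" using y uv by auto
      have "norm ((LINT w|lebesgue. poisson_kernel u (v - w) *\<^sub>R g w) - g x) \<le> A * (e / (2 * A))"
        using bound[OF u(1,3)] mult_left_mono[OF d(2)[OF u(1,2)], of A] A by linarith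
      also have "\<dots> < e" using A e by simp
      finally show "dist (case y of (u, v) \<Rightarrow> LINT w|lebesgue. poisson_kernel u (v - w) *\<^sub>R g w) (g x) < e"
        by (simp add: uv dist_norm)
    qed
  qed
qed

section \<open>Membership in the slice Hardy space\<close>

lemma AE_lborel_uminus:
  assumes "AE x in lborel. P x"
  shows "AE x in lborel. P (- x :: real)"
proof -
  obtain N where N: "N \<in> null_sets lborel" "{x \<in> space lborel. \<not> P x} \<subseteq> N"
    using assms by (auto elim: AE_E simp: null_sets_def)
  have "AE x in distr lborel borel uminus. x \<notin> N"
    unfolding lborel_distr_uminus by (rule AE_not_in[OF N(1)])
  then have "AE x in lborel. - x \<notin> N"
    using N(1) by (subst (asm) AE_distr_iff) (auto simp: null_sets_def)
  then show ?thesis by eventually_elim (use N(2) in auto)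
qed

theorem theorem3p4:
  fixes f :: "'n::{finite,linorder} paravec \<Rightarrow> 'n cliff" and p :: real
  assumes "1 \<le> p" and "p \<le> 2"
    and "\<exists>I\<in>imag_units. poisson_extended I f \<and> (\<lambda>v. f (slice_pt I 0 v)) \<in> Lp p \<and>
           (\<exists>h. has_cl_fourier p I (\<lambda>v. f (slice_pt I 0 v)) h \<and> ess_support h \<subseteq> {..0})"
  shows "f \<in> Hp_slice p"
proof -
  obtain I h where I: "I \<in> imag_units" and ext: "poisson_extended I f"
      and g: "(\<lambda>v. f (slice_pt I 0 v)) \<in> Lp p"
      and h: "has_cl_fourier p I (\<lambda>v. f (slice_pt I 0 v)) h" "ess_support h \<subseteq> {..0}"
    using assms(3) by blast
  note p = assms(1,2)
  define g where "g v = f (slice_pt I 0 v)" for v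
  note g = g[folded g_def] and h = h(1)[folded g_def] h(2)
  have poisson: "f (slice_pt I u v) = (LINT w|lebesgue. poisson_kernel u (v - w) *\<^sub>R g w)" if "u > 0" for u v
    using ext that by (simp add: poisson_extended_def g_def)
  have rep: "f (slice_pt J u v) = (1/2) *\<^sub>R (f (slice_pt I u (-v)) + f (slice_pt I u v))
      + cl_vec J \<odot> ((1/2) *\<^sub>R (cl_vec I \<odot> (f (slice_pt I u (-v)) - f (slice_pt I u v))))"
    if "J \<in> imag_units" "u > 0" for J u v
    using ext that by (simp add: poisson_extended_def cl_mult_assoc cl_mult.scaleR_right)

  define \<Phi> where "\<Phi> z = f (slice_pt I (Re z) (Im z))" for z
  have hol: "\<exists>D. (\<Phi> has_derivative (\<lambda>h. cl_act I h D)) (at z)" if z: "Re z > 0" for z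
  proof -
    let ?S = "\<lambda>z. LINT w|lebesgue. cl_act I (1 / (z - \<i> * of_real w)) (g w)"
    obtain D where D: "(?S has_derivative (\<lambda>h. cl_act I h D)) (at z)"
      using cauchy_integral_has_derivative[OF p I g z] by blast
    have eq: "(1 / (2 * pi)) *\<^sub>R ?S y = \<Phi> y" if y: "Re y > 0" for y
      using poisson_integral_split[OF p g y, of "Im y" I] poisson[OF y, of "Im y"]
        conjugate_cauchy_integral_eq_0[OF p I g h y]
      by (simp add: \<Phi>_def)
    have "((\<lambda>y. (1 / (2 * pi)) *\<^sub>R ?S y) has_derivative (\<lambda>h. cl_act I h ((1 / (2 * pi)) *\<^sub>R D))) (at z)"
      unfolding cl_act.scaleR_right by (rule has_derivative_scaleR_right[OF D])
    then have "(\<Phi> has_derivative (\<lambda>h. cl_act I h ((1 / (2 * pi)) *\<^sub>R D))) (at z)"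
      by (rule has_derivative_transform_within_open[OF _ open_halfspace_Re_gt]) (use z eq in auto)
    then show ?thesis by blast
  qed
  have SM: "f \<in> slice_monogenic half_space"
  proof (rule slice_monogenic_of_stem)
    show "\<exists>a b. ((\<lambda>z. (1/2) *\<^sub>R (\<Phi> (cnj z) + \<Phi> z)) has_derivative (\<lambda>h. Re h *\<^sub>R a - Im h *\<^sub>R b)) (at z) \<and>
      ((\<lambda>z. (1/2) *\<^sub>R (cl_vec I \<odot> (\<Phi> (cnj z) - \<Phi> z))) has_derivative (\<lambda>h. Re h *\<^sub>R b + Im h *\<^sub>R a)) (at z)"
      if "Re z > 0" for z
      by (rule stem_function_derivatives[OF I that hol])
    show "(1/2) *\<^sub>R (cl_vec I \<odot> (\<Phi> (cnj (of_real u)) - \<Phi> (of_real u))) = 0" for u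
      by (simp add: cl_mult.zero_right)
    show "f (slice_pt J u v) = (1/2) *\<^sub>R (\<Phi> (cnj (Complex u v)) + \<Phi> (Complex u v))
        + cl_vec J \<odot> ((1/2) *\<^sub>R (cl_vec I \<odot> (\<Phi> (cnj (Complex u v)) - \<Phi> (Complex u v))))"
      if "J \<in> imag_units" "u > 0" for J u v
      unfolding \<Phi>_def using rep[OF that, of v] by simp
  qed

  define F where "F J v = (1/2) *\<^sub>R (g (-v) + g v) + cl_vec J \<odot> ((1/2) *\<^sub>R (cl_vec I \<odot> (g (-v) - g v)))"
    for J :: "(real, 'n) vec" and v
  have gm: "g \<in> borel_measurable lebesgue" using g by (simp add: Lp_def)
  have lp: "AE x in lborel. \<forall>e>0. \<exists>d>0. \<forall>r. 0 < r \<longrightarrow> r < d \<longrightarrow>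
      (\<integral>\<^sup>+y\<in>ball x r. norm (g y - g x) \<partial>lborel) \<le> ennreal (e * r)"
    by (rule AE_lebesgue_point[OF gm Lp_locally_integrable[OF p(1) g]])
  have nt: "AE x in lborel. nontangential_limit f I x (g x)"
    using lp
  proof eventually_elim
    case (elim x)
    show ?case unfolding nontangential_limit_def
    proof (intro allI impI)
      fix \<alpha> :: real assume \<alpha>: "\<alpha> > 0"
      have "((\<lambda>(u, v). LINT w|lebesgue. poisson_kernel u (v - w) *\<^sub>R g w) \<longlongrightarrow> g x)
        (at (0, x) within {(u, v). u > 0 \<and> \<bar>v - x\<bar> < \<alpha> * u})"
        by (rule poisson_integral_nontangential_limit[OF p g _ \<alpha>]) (use elim in blast)
      then show "((\<lambda>(u, v). f (slice_pt I u v)) \<longlongrightarrow> g x) (at (0, x) within {(u, v). u > 0 \<and> \<bar>v - x\<bar> < \<alpha> * u})"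
        by (rule Lim_transform_eventually) (auto simp: eventually_at_filter poisson intro!: always_eventually)
    qed
  qed
  have nt': "AE x in lborel. nontangential_limit f I x (g x) \<and> nontangential_limit f I (- x) (g (- x))"
    using nt AE_lborel_uminus[OF nt] by eventually_elim simp
  have boundary: "AE v in lebesgue. nontangential_limit f J v (F J v)" if J: "J \<in> imag_units" for J
    unfolding AE_completion_iff using nt'
  proof eventually_elim
    case (elim x)
    show ?case unfolding nontangential_limit_def
    proof (intro allI impI)
      fix \<alpha> :: real assume \<alpha>: "\<alpha> > 0"
      let ?W = "\<lambda>x. {(u, v). u > 0 \<and> \<bar>v - x\<bar> < \<alpha> * u} :: (real \<times> real) set"
      have L1: "((\<lambda>(u, v). f (slice_pt I u v)) \<longlongrightarrow> g x) (at (0, x) within ?W x)"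
        using elim \<alpha> unfolding nontangential_limit_def by blast
      have L2: "((\<lambda>(u, v). f (slice_pt I u v)) \<longlongrightarrow> g (- x)) (at (0, - x) within ?W (- x))"
        using elim \<alpha> unfolding nontangential_limit_def by blast
      \<comment> \<open>The cone at \<open>x\<close> is mirrored onto the cone at \<open>- x\<close>, where the limit is \<open>g (- x)\<close>.\<close>
      have "filterlim (\<lambda>(u, v). (u, - v)) (at (0, - x) within ?W (- x)) (at (0, x) within ?W x)"
        unfolding filterlim_at
      proof
        show "\<forall>\<^sub>F y in at (0, x) within ?W x. (case y of (u, v) \<Rightarrow> (u, - v)) \<in> ?W (- x) \<and> (case y of (u, v) \<Rightarrow> (u, - v)) \<noteq> (0, - x)"
          unfolding eventually_at_filter by (rule always_eventually) (auto simp: abs_minus_commute)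
        show "((\<lambda>(u, v). (u, - v)) \<longlongrightarrow> (0, - x)) (at (0, x) within ?W x)"
          using tendsto_Pair[OF tendsto_fst[OF tendsto_ident_at] tendsto_minus[OF tendsto_snd[OF tendsto_ident_at]], of "(0, x)" "?W x"]
          by (simp add: case_prod_beta')
      qed
      from filterlim_compose[OF L2 this]
      have mirrored: "((\<lambda>y. f (slice_pt I (fst y) (- snd y))) \<longlongrightarrow> g (- x)) (at (0, x) within ?W x)"
        by (simp add: case_prod_beta')
      have here: "((\<lambda>y. f (slice_pt I (fst y) (snd y))) \<longlongrightarrow> g x) (at (0, x) within ?W x)"
        using L1 by (simp add: case_prod_beta')
      have "((\<lambda>y. (1/2) *\<^sub>R (f (slice_pt I (fst y) (- snd y)) + f (slice_pt I (fst y) (snd y)))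
          + cl_vec J \<odot> ((1/2) *\<^sub>R (cl_vec I \<odot> (f (slice_pt I (fst y) (- snd y)) - f (slice_pt I (fst y) (snd y))))))
          \<longlongrightarrow> F J x) (at (0, x) within ?W x)"
        unfolding F_def by (intro tendsto_intros cl_mult.tendsto here mirrored)
      then show "((\<lambda>(u, v). f (slice_pt J u v)) \<longlongrightarrow> F J x) (at (0, x) within ?W x)"
        by (rule Lim_transform_eventually)
           (auto simp: eventually_at_filter rep[OF J] intro!: always_eventually)
    qed
  qed

  obtain K where K: "K > 0" "\<And>(x :: 'n cliff) y. norm (x \<odot> y) \<le> norm x * norm y * K"
    using cl_mult.pos_bounded by blast
  obtain L where L: "L > 0" "\<And>x :: (real, 'n) vec. norm (cl_vec x) \<le> norm x * L"
    using bounded_linear.pos_bounded[OF bounded_linear_cl_vec] by blast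
  define M where "M = 1 + (L * K)\<^sup>2"
  have M: "M > 0" unfolding M_def by (simp add: add_pos_nonneg)
  have Fle: "norm (F J v) powr p \<le> (M * 2) powr p * (norm (g v) powr p + norm (g (- v)) powr p)" if J: "J \<in> imag_units" for J v
  proof -
    have vec: "norm (cl_vec y \<odot> X) \<le> L * K * norm X" if "y \<in> imag_units" for y :: "(real, 'n) vec" and X
    proof -
      have "norm (cl_vec y) \<le> L" using L(2)[of y] that by (simp add: imag_units_iff_norm)
      then have "norm (cl_vec y) * norm X * K \<le> L * norm X * K" using K(1) by (intro mult_right_mono) auto
      then show ?thesis using K(2)[of "cl_vec y" X] by (simp add: mult_ac)
    qed
    define s where "s = norm (g v) + norm (g (- v))"
    have s: "s \<ge> 0" by (simp add: s_def)
    have m: "norm (g (- v) - g v) \<le> s" "norm (g (- v) + g v) \<le> s"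
      using norm_triangle_ineq4[of "g (- v)" "g v"] norm_triangle_ineq[of "g (- v)" "g v"] by (simp_all add: s_def)
    have "norm (cl_vec J \<odot> ((1/2) *\<^sub>R (cl_vec I \<odot> (g (-v) - g v)))) \<le> L * K * norm ((1/2) *\<^sub>R (cl_vec I \<odot> (g (-v) - g v)))"
      by (rule vec[OF J])
    also have "\<dots> \<le> L * K * (L * K * s)"
    proof (rule mult_left_mono)
      have "norm (cl_vec I \<odot> (g (-v) - g v)) \<le> L * K * norm (g (-v) - g v)" by (rule vec[OF I])
      also have "\<dots> \<le> L * K * s" using m(1) L(1) K(1) by (intro mult_left_mono) auto
      finally have "norm (cl_vec I \<odot> (g (-v) - g v)) \<le> L * K * s" .
      moreover have "norm ((1/2) *\<^sub>R X) \<le> norm X" for X :: "'n cliff" by simp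
      ultimately show "norm ((1/2) *\<^sub>R (cl_vec I \<odot> (g (-v) - g v))) \<le> L * K * s"
        by (rule order_trans[rotated])
    qed (use L K in simp)
    finally have t2: "norm (cl_vec J \<odot> ((1/2) *\<^sub>R (cl_vec I \<odot> (g (-v) - g v)))) \<le> (L * K)\<^sup>2 * s"
      by (simp add: power2_eq_square mult_ac)
    have t1: "norm ((1/2) *\<^sub>R (g (-v) + g v)) \<le> s" using m(2) s by simp
    have "norm (F J v) \<le> M * s"
      using norm_triangle_le[OF add_mono[OF t1 t2]] by (simp add: F_def M_def algebra_simps)
    also have "\<dots> \<le> M * (2 * max (norm (g v)) (norm (g (- v))))"
      using M by (intro mult_left_mono) (auto simp: s_def)
    finally have "norm (F J v) powr p \<le> (M * (2 * max (norm (g v)) (norm (g (- v))))) powr p"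
      using p by (intro powr_mono2) auto
    also have "\<dots> = (M * 2) powr p * max (norm (g v)) (norm (g (- v))) powr p"
      using M by (simp only: mult.assoc[symmetric]) (subst powr_mult, auto)
    also have "\<dots> \<le> (M * 2) powr p * (norm (g v) powr p + norm (g (- v)) powr p)"
      by (intro mult_left_mono) (auto simp: max_def)
    finally show ?thesis .
  qed
  have gi: "integrable lebesgue (\<lambda>v. norm (g v) powr p)" using g by (simp add: Lp_def)
  have "(SUP J\<in>imag_units. \<integral>\<^sup>+v. ennreal (norm (F J v) powr p) \<partial>lebesgue)
      \<le> (\<integral>\<^sup>+v. ennreal ((M * 2) powr p * (norm (g v) powr p + norm (g (- v)) powr p)) \<partial>lebesgue)"
    using Fle by (intro SUP_least nn_integral_mono ennreal_leI)
  also have "\<dots> < \<infinity>"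
  proof -
    have "integrable lebesgue (\<lambda>v. norm (g (- v)) powr p)"
      using lebesgue_integrable_real_affine[OF gi, of "-1" 0] by simp
    with gi have "integrable lebesgue (\<lambda>v. (M * 2) powr p * (norm (g v) powr p + norm (g (- v)) powr p))"
      by (intro integrable_mult_right Bochner_Integration.integrable_add)
    from nn_integral_eq_integral[OF this] show ?thesis by simp
  qed
  finally have "(SUP J\<in>imag_units. \<integral>\<^sup>+v. ennreal (norm (F J v) powr p) \<partial>lebesgue) < \<infinity>" .
  then show ?thesis
    unfolding Hp_slice_def using SM boundary by blast
qed

end
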